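(* Given a nice tree decomposition of width $\mathrm{tw}$ of the input graph, \textsc{Generalized Fair Matching} can be solved in time $O^*(\mathrm{tw}^{\mathrm{tw}}\, 2^{\Delta_V(\mathrm{tw}+3)})$, where $\Delta_V$ is the maximum degree of a vertex in $V$.
   Context: Let $G=(U\cup V,E)$ be a bipartite graph with bipartition $(U,V)$. For $x\in U\cup V$ and $M\subseteq E$, let $M(x)=\{y : xy\in M\}$. A subset $M\subseteq E$ is a left-perfect many-to-one matching if $|M(u)|=1$ for every $u\in U$. Let $C$ be a finite set of colors and $\mathrm{col}:U\to C$ a coloring; for $U'\subseteq U$ and $c\in C$, $U'_c$ denotes the set of vertices of $U'$ of color $c$. For an integer $\ell\ge 0$, $U'$ is $\ell$-fair if $\max_{c\in C}|U'_c|-\min_{c\in C}|U'_c|\le \ell$ (min and max range over all colors of $C$). Given a threshold function $L:V\to\mathbb{N}\cup\{0\}$, a many-to-one matching $M$ is $L$-fair if $M(v)$ is $L(v)$-fair for every $v\in V$. \textsc{Generalized Fair Matching}: given a bipartite graph $G=(U\cup V,E)$, a set of colors $C$, a coloring $\mathrm{col}:U\to C$ and a threshold function $L:V\to\mathbb{N}\cup\{0\}$, decide whether $G$ has a left-perfect many-to-one matching that is $L$-fair. Nice tree decompositions and treewidth are the standard notions. $O^*(\cdot)$ suppresses factors polynomial in the input size. *)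

theory Defs
  imports Main "HOL-Computational_Algebra.Polynomial"
begin

section \<open>Fair matchings in bipartite graphs\<close>

record ('v, 'c) fair_instance =
  left :: "'v set"
  right :: "'v set"
  edges :: "'v set set"
  colors :: "'c set"
  col :: "'v \<Rightarrow> 'c"
  threshold :: "'v \<Rightarrow> nat"

definition bipartite_graph :: "'v set \<Rightarrow> 'v set \<Rightarrow> 'v set set \<Rightarrow> bool" where
  "bipartite_graph U V E \<longleftrightarrow>
     finite U \<and> finite V \<and> U \<inter> V = {} \<and> (\<forall>e\<in>E. \<exists>u\<in>U. \<exists>v\<in>V. e = {u, v})"

text \<open>The set of colors is nonempty: otherwise the maximum and the minimum over all colors
  do not exist.\<close>

definition valid_instance :: "('v, 'c) fair_instance \<Rightarrow> bool" where
  "valid_instance I \<longleftrightarrow>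
     bipartite_graph (left I) (right I) (edges I) \<and>
     finite (colors I) \<and> colors I \<noteq> {} \<and> col I ` left I \<subseteq> colors I"

text \<open>For a set \<open>M\<close> of edges, \<open>nbrs M x\<close> is \<open>M(x)\<close>; \<open>nbrs E x\<close> is the neighborhood.\<close>

definition nbrs :: "'v set set \<Rightarrow> 'v \<Rightarrow> 'v set" where
  "nbrs M x = {y. {x, y} \<in> M}"

definition left_perfect :: "'v set \<Rightarrow> 'v set set \<Rightarrow> 'v set set \<Rightarrow> bool" where
  "left_perfect U E M \<longleftrightarrow> M \<subseteq> E \<and> (\<forall>u\<in>U. card (nbrs M u) = 1)"

definition color_count :: "('v \<Rightarrow> 'c) \<Rightarrow> 'v set \<Rightarrow> 'c \<Rightarrow> nat" where
  "color_count f S c = card {x \<in> S. f x = c}"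

text \<open>The maximum is at least the minimum, so the subtraction on \<open>nat\<close> is exact.\<close>

definition fair :: "'c set \<Rightarrow> ('v \<Rightarrow> 'c) \<Rightarrow> nat \<Rightarrow> 'v set \<Rightarrow> bool" where
  "fair C f l S \<longleftrightarrow> Max (color_count f S ` C) - Min (color_count f S ` C) \<le> l"

definition matching_fair :: "('v, 'c) fair_instance \<Rightarrow> 'v set set \<Rightarrow> bool" where
  "matching_fair I M \<longleftrightarrow>
     (\<forall>v\<in>right I. fair (colors I) (col I) (threshold I v) (nbrs M v))"

definition generalized_fair_matching :: "('v, 'c) fair_instance \<Rightarrow> bool" where
  "generalized_fair_matching I \<longleftrightarrow>
     (\<exists>M. left_perfect (left I) (edges I) M \<and> matching_fair I M)"

text \<open>The supremum of the empty set of naturals is \<open>0\<close>; this matters only if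
  \<open>right I\<close> is empty.\<close>

definition max_right_degree :: "('v, 'c) fair_instance \<Rightarrow> nat" where
  "max_right_degree I = (SUP v\<in>right I. card (nbrs (edges I) v))"

section \<open>Nice tree decompositions\<close>

text \<open>A tree decomposition is a finite rooted tree whose nodes carry bags. A node is addressed by
  the list of child indices on the path from the root to it.\<close>

datatype 'b rtree = Node (label: 'b) (children: "'b rtree list")

fun subtree :: "'b rtree \<Rightarrow> nat list \<Rightarrow> 'b rtree" where
  "subtree t [] = t"
| "subtree t (i # p) = subtree (children t ! i) p"

fun is_node :: "'b rtree \<Rightarrow> nat list \<Rightarrow> bool" where
  "is_node t [] \<longleftrightarrow> True"
| "is_node t (i # p) \<longleftrightarrow> i < length (children t) \<and> is_node (children t ! i) p"

definition nodes :: "'b rtree \<Rightarrow> nat list set" where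
  "nodes t = {p. is_node t p}"

definition bag :: "'v set rtree \<Rightarrow> nat list \<Rightarrow> 'v set" where
  "bag t p = label (subtree t p)"

definition connected_nodes :: "nat list set \<Rightarrow> bool" where
  "connected_nodes S \<longleftrightarrow>
     (\<forall>p\<in>S. \<forall>q\<in>S. (p, q) \<in>
        {(a, b). a \<in> S \<and> b \<in> S \<and> (\<exists>i. b = a @ [i] \<or> a = b @ [i])}\<^sup>*)"

definition tree_decomposition :: "'v set \<Rightarrow> 'v set set \<Rightarrow> 'v set rtree \<Rightarrow> bool" where
  "tree_decomposition W E t \<longleftrightarrow>
     (\<forall>p\<in>nodes t. bag t p \<subseteq> W) \<and>
     (\<forall>v\<in>W. \<exists>p\<in>nodes t. v \<in> bag t p) \<and>
     (\<forall>e\<in>E. \<exists>p\<in>nodes t. e \<subseteq> bag t p) \<and>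
     (\<forall>v\<in>W. connected_nodes {p \<in> nodes t. v \<in> bag t p})"

definition leaf_node :: "'v set rtree \<Rightarrow> bool" where
  "leaf_node t \<longleftrightarrow> children t = [] \<and> label t = {}"

definition introduce_node :: "'v set rtree \<Rightarrow> bool" where
  "introduce_node t \<longleftrightarrow>
     (\<exists>s v. children t = [s] \<and> v \<notin> label s \<and> label t = insert v (label s))"

definition forget_node :: "'v set rtree \<Rightarrow> bool" where
  "forget_node t \<longleftrightarrow>
     (\<exists>s v. children t = [s] \<and> v \<in> label s \<and> label t = label s - {v})"

definition join_node :: "'v set rtree \<Rightarrow> bool" where
  "join_node t \<longleftrightarrow>
     (\<exists>s s'. children t = [s, s'] \<and> label s = label t \<and> label s' = label t)"

definition nice_tree_decomposition :: "'v set \<Rightarrow> 'v set set \<Rightarrow> 'v set rtree \<Rightarrow> bool" where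
  "nice_tree_decomposition W E t \<longleftrightarrow>
     tree_decomposition W E t \<and> label t = {} \<and>
     (\<forall>p\<in>nodes t. let s = subtree t p in
        leaf_node s \<or> introduce_node s \<or> forget_node s \<or> join_node s)"

text \<open>The subtraction is truncated only if all bags are empty, that is, for the graph
  without vertices, which thereby gets width \<open>0\<close> instead of \<open>-1\<close>.\<close>

definition width :: "'v set rtree \<Rightarrow> nat" where
  "width t = Max ((\<lambda>p. card (bag t p)) ` nodes t) - 1"

section \<open>Programs and their running time\<close>

text \<open>The model of computation is first-order pure Lisp over binary trees with a single atom.
  A program is a list of function bodies, referring to their arguments by position; functions may
  call each other recursively. Every evaluation step of an expression costs one unit. As there is
  neither a test for structural equality nor arithmetic, each primitive takes constant time on a
  pointer machine or random access machine that represents trees by shared cells. Conversely, a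
  random access machine with memory organized as a balanced tree is simulated with an overhead per
  step that is polynomial in the lengths of the addresses and register contents, which is
  absorbed by the polynomial factor in the time bound.\<close>

datatype sexp = Atom | Dot sexp sexp

datatype expr =
    Var nat
  | Empty
  | Cell expr expr
  | Fst expr
  | Snd expr
  | IfPair expr expr expr
  | Call nat "expr list"

type_synonym program = "expr list"

fun sfst :: "sexp \<Rightarrow> sexp" where
  "sfst Atom = Atom"
| "sfst (Dot a b) = a"

fun ssnd :: "sexp \<Rightarrow> sexp" where
  "ssnd Atom = Atom"
| "ssnd (Dot a b) = b"

text \<open>\<open>evaluates P env e v n\<close>: in program \<open>P\<close>, with argument values \<open>env\<close>, expression \<open>e\<close>
  evaluates to \<open>v\<close> at cost \<open>n\<close>. Diverging and ill-formed expressions have no value.\<close>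

inductive evaluates :: "program \<Rightarrow> sexp list \<Rightarrow> expr \<Rightarrow> sexp \<Rightarrow> nat \<Rightarrow> bool"
  and evaluates_list :: "program \<Rightarrow> sexp list \<Rightarrow> expr list \<Rightarrow> sexp list \<Rightarrow> nat \<Rightarrow> bool"
  for P :: program where
  Var: "i < length env \<Longrightarrow> evaluates P env (Var i) (env ! i) 1"
| Empty: "evaluates P env Empty Atom 1"
| Cell: "evaluates P env e a m \<Longrightarrow> evaluates P env f b n \<Longrightarrow>
    evaluates P env (Cell e f) (Dot a b) (1 + m + n)"
| Fst: "evaluates P env e a n \<Longrightarrow> evaluates P env (Fst e) (sfst a) (1 + n)"
| Snd: "evaluates P env e a n \<Longrightarrow> evaluates P env (Snd e) (ssnd a) (1 + n)"
| IfPair_True: "evaluates P env e a m \<Longrightarrow> a \<noteq> Atom \<Longrightarrow> evaluates P env f b n \<Longrightarrow>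
    evaluates P env (IfPair e f g) b (1 + m + n)"
| IfPair_False: "evaluates P env e Atom m \<Longrightarrow> evaluates P env g b n \<Longrightarrow>
    evaluates P env (IfPair e f g) b (1 + m + n)"
| Call: "i < length P \<Longrightarrow> evaluates_list P env es as m \<Longrightarrow> evaluates P as (P ! i) b n \<Longrightarrow>
    evaluates P env (Call i es) b (1 + m + n)"
| Args_Nil: "evaluates_list P env [] [] 0"
| Args_Cons: "evaluates P env e a m \<Longrightarrow> evaluates_list P env es as n \<Longrightarrow>
    evaluates_list P env (e # es) (a # as) (m + n)"

inductive_cases evaluates_cases:
  "evaluates P env (Var i) v n"
  "evaluates P env Empty v n"
  "evaluates P env (Cell e f) v n"
  "evaluates P env (Fst e) v n"
  "evaluates P env (Snd e) v n"
  "evaluates P env (IfPair e f g) v n"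
  "evaluates P env (Call i es) v n"
  "evaluates_list P env [] vs n"
  "evaluates_list P env (e # es) vs n"

lemma evaluates_deterministic_aux:
  "(evaluates P env e v n \<longrightarrow> (\<forall>w m. evaluates P env e w m \<longrightarrow> w = v \<and> m = n)) \<and>
   (evaluates_list P env' es vs n' \<longrightarrow>
     (\<forall>ws m. evaluates_list P env' es ws m \<longrightarrow> ws = vs \<and> m = n'))"
  apply (rule evaluates_evaluates_list.induct; intro allI impI)
           apply (erule evaluates_cases(1), simp)
          apply (erule evaluates_cases(2), simp)
         apply (erule evaluates_cases(3), metis plus_1_eq_Suc add_Suc)
        apply (erule evaluates_cases(4), metis plus_1_eq_Suc)
       apply (erule evaluates_cases(5), metis plus_1_eq_Suc)
      apply (erule evaluates_cases(6); metis plus_1_eq_Suc add_Suc)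
     apply (erule evaluates_cases(6); metis plus_1_eq_Suc add_Suc)
    apply (erule evaluates_cases(7), metis plus_1_eq_Suc add_Suc)
   apply (erule evaluates_cases(8), simp)
  apply (erule evaluates_cases(9), metis)
  done

lemma evaluates_deterministic:
  assumes "evaluates P env e v n" "evaluates P env e w m"
  shows "w = v" "m = n"
  using assms evaluates_deterministic_aux by blast+

text \<open>Function \<open>0\<close> is the main function; a result other than the atom means \<open>yes\<close>.\<close>

definition decides_within :: "program \<Rightarrow> sexp \<Rightarrow> bool \<Rightarrow> nat \<Rightarrow> bool" where
  "decides_within P x answer T \<longleftrightarrow>
     (\<exists>v n. evaluates P [x] (Call 0 [Var 0]) v n \<and> (v \<noteq> Atom \<longleftrightarrow> answer) \<and> n \<le> T)"

section \<open>Encoding of inputs\<close>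

text \<open>Numbers (including names of vertices and colors) are written in binary, least significant
  bit first, without leading zeros.\<close>

fun enc_nat :: "nat \<Rightarrow> sexp" where
  "enc_nat n = (if n = 0 then Atom
     else Dot (if even n then Atom else Dot Atom Atom) (enc_nat (n div 2)))"

declare enc_nat.simps [simp del]

definition enc_list :: "sexp list \<Rightarrow> sexp" where
  "enc_list xs = foldr Dot xs Atom"

definition enc_set :: "nat set \<Rightarrow> sexp" where
  "enc_set A = enc_list (map enc_nat (sorted_list_of_set A))"

text \<open>The graph is given by the adjacency lists of its left vertices.\<close>

definition enc_instance :: "(nat, nat) fair_instance \<Rightarrow> sexp" where
  "enc_instance I = enc_list
    [enc_list (map (\<lambda>u. enc_list [enc_nat u, enc_nat (col I u), enc_set (nbrs (edges I) u)])
       (sorted_list_of_set (left I))),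
     enc_list (map (\<lambda>v. enc_list [enc_nat v, enc_nat (threshold I v)])
       (sorted_list_of_set (right I))),
     enc_set (colors I)]"

primrec enc_tree :: "nat set rtree \<Rightarrow> sexp" where
  "enc_tree (Node X ts) = Dot (enc_set X) (enc_list (map enc_tree ts))"

text \<open>The size of an input is the number of pairs of its encoding, given by \<open>size\<close>.\<close>

definition enc_input :: "(nat, nat) fair_instance \<Rightarrow> nat set rtree \<Rightarrow> sexp" where
  "enc_input I t = Dot (enc_instance I) (enc_tree t)"

end

theory Submission
  imports Defs
begin

text \<open>Dynamic programming over the tree decomposition. A state of a bag records, for every right
  vertex of the bag, the complete set of its partners (at most \<open>2\<^sup>\<Delta>\<close> choices) and, for every left
  vertex of the bag, one bit that tells whether its partner has already been forgotten. A partner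
  in the bag is visible in the sets of the right vertices, and so the requirement that a left
  vertex has exactly one partner is checked only when it is forgotten; fairness of a right vertex
  is checked when that vertex is forgotten.

  The set of feasible states of a bag is stored as a complete binary decision tree, so that a lookup
  is polynomial and duplicates cannot arise. The table of a node is filled state by state from the
  tables of its children. A join node splits the left vertices whose partner has been forgotten
  among its two subtrees, and a forget node tries all partner sets of the forgotten right vertex.
  With bags of at most \<open>w + 1\<close> vertices this costs \<open>2\<^sup>\<Delta>\<close> for each right vertex of the bag and at most a
  constant factor for each left vertex, in total \<open>2 ^ ((\<Delta> + 2) (w + 1))\<close> up to polynomial factors; and
  \<open>4 ^ (w + 1) \<le> 16 w ^ w\<close>.\<close>

section \<open>Values and costs of calls\<close>

text \<open>The join is what shapes the states. With complete partner sets, including partners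
  outside the bag, right vertices are free there: both children must hold the same set, whereas
  color counts would have to be split and added. Only the bit of a left vertex is divided: if its
  partner is forgotten, it is forgotten below exactly one child. So a left vertex contributes a
  factor 2 for its bit and a factor 2 for this split, the origin of \<open>4 ^ (w + 1)\<close>.
  Guessing the partner set at a forget node needs no extra factor, because the bag of the node is
  one vertex smaller than the bag of its child. The degree enters the exponent only with factor
  \<open>w + 1\<close>; the rest of \<open>w + 3\<close> is slack.

  The other obstacle is a language without loops, equality or arithmetic. Termination, value and
  cost of a call are proved together, by induction over the data; evaluation is deterministic, so
  value and cost are functions of the call.\<close>

definition returns :: "program \<Rightarrow> nat \<Rightarrow> sexp list \<Rightarrow> sexp \<Rightarrow> nat \<Rightarrow> bool" where
  "returns P i as v n \<longleftrightarrow> i < length P \<and> evaluates P as (P ! i) v n"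

definition halts :: "program \<Rightarrow> nat \<Rightarrow> sexp list \<Rightarrow> bool" where
  "halts P i as \<longleftrightarrow> (\<exists>v n. returns P i as v n)"

definition result :: "program \<Rightarrow> nat \<Rightarrow> sexp list \<Rightarrow> sexp" where
  "result P i as = (THE v. \<exists>n. returns P i as v n)"

definition cost :: "program \<Rightarrow> nat \<Rightarrow> sexp list \<Rightarrow> nat" where
  "cost P i as = (THE n. \<exists>v. returns P i as v n)"

text \<open>A symbolic evaluator for a single body: calls are left as \<open>result\<close> and
  \<open>cost\<close>, so the recursion is over the syntax, however the functions call each
  other.\<close>

primrec expr_val :: "program \<Rightarrow> sexp list \<Rightarrow> expr \<Rightarrow> sexp" where
  "expr_val P env (Var i) = env ! i"
| "expr_val P env Empty = Atom"
| "expr_val P env (Cell e f) = Dot (expr_val P env e) (expr_val P env f)"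
| "expr_val P env (Fst e) = sfst (expr_val P env e)"
| "expr_val P env (Snd e) = ssnd (expr_val P env e)"
| "expr_val P env (IfPair e f g) =
    (if expr_val P env e = Atom then expr_val P env g else expr_val P env f)"
| "expr_val P env (Call i es) = result P i (map (expr_val P env) es)"

primrec expr_cost :: "program \<Rightarrow> sexp list \<Rightarrow> expr \<Rightarrow> nat" where
  "expr_cost P env (Var i) = 1"
| "expr_cost P env Empty = 1"
| "expr_cost P env (Cell e f) = 1 + expr_cost P env e + expr_cost P env f"
| "expr_cost P env (Fst e) = 1 + expr_cost P env e"
| "expr_cost P env (Snd e) = 1 + expr_cost P env e"
| "expr_cost P env (IfPair e f g) = 1 + expr_cost P env e +
    (if expr_val P env e = Atom then expr_cost P env g else expr_cost P env f)"
| "expr_cost P env (Call i es) =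
    1 + sum_list (map (expr_cost P env) es) + cost P i (map (expr_val P env) es)"

text \<open>Only the branch that is taken has to be defined; this lets a recursive function reach
  its base case.\<close>

primrec expr_defined :: "program \<Rightarrow> sexp list \<Rightarrow> expr \<Rightarrow> bool" where
  "expr_defined P env (Var i) \<longleftrightarrow> i < length env"
| "expr_defined P env Empty \<longleftrightarrow> True"
| "expr_defined P env (Cell e f) \<longleftrightarrow> expr_defined P env e \<and> expr_defined P env f"
| "expr_defined P env (Fst e) \<longleftrightarrow> expr_defined P env e"
| "expr_defined P env (Snd e) \<longleftrightarrow> expr_defined P env e"
| "expr_defined P env (IfPair e f g) \<longleftrightarrow> expr_defined P env e \<and>
    (if expr_val P env e = Atom then expr_defined P env g else expr_defined P env f)"
| "expr_defined P env (Call i es) \<longleftrightarrow>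
    list_all id (map (expr_defined P env) es) \<and> halts P i (map (expr_val P env) es)"

lemma returns_unique:
  assumes "returns P i as v n"
  shows "result P i as = v" "cost P i as = n"
  using assms evaluates_deterministic unfolding returns_def result_def cost_def by blast+

lemma returns_result_cost: "halts P i as \<Longrightarrow> returns P i as (result P i as) (cost P i as)"
  using returns_unique unfolding halts_def by blast

lemma evaluates_list_map:
  "(\<And>e. e \<in> set es \<Longrightarrow> evaluates P env e (f e) (g e)) \<Longrightarrow>
   evaluates_list P env es (map f es) (sum_list (map g es))"
  by (induction es) (auto intro: evaluates_evaluates_list.intros)

lemma evaluates_expr_val:
  "expr_defined P env e \<Longrightarrow> evaluates P env e (expr_val P env e) (expr_cost P env e)"
proof (induction e)
  case (Call i es)
  have "evaluates_list P env es (map (expr_val P env) es) (sum_list (map (expr_cost P env) es))"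
    using Call by (intro evaluates_list_map) (auto simp: list_all_iff)
  moreover have "returns P i (map (expr_val P env) es)
      (result P i (map (expr_val P env) es)) (cost P i (map (expr_val P env) es))"
    using Call.prems by (intro returns_result_cost) simp
  ultimately show ?case
    unfolding returns_def using evaluates_evaluates_list.Call[of i P env es] by fastforce
qed (auto intro: evaluates_evaluates_list.intros simp del: One_nat_def split: if_splits)

text \<open>\<open>result\<close> and \<open>cost\<close> are definite descriptions and say nothing
  about a diverging call, hence the conjunct \<open>halts\<close>. The cost is only bounded, so that
  bounds of callees can be combined.\<close>

definition computes :: "program \<Rightarrow> nat \<Rightarrow> sexp list \<Rightarrow> sexp \<Rightarrow> nat \<Rightarrow> bool" where
  "computes P i as v T \<longleftrightarrow> halts P i as \<and> result P i as = v \<and> cost P i as \<le> T"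

text \<open>Unfolds one body. The calls in it are covered by facts of the form
  \<open>computes\<close>, either earlier ones or the induction hypothesis.\<close>

lemma computesI:
  assumes "i < length P" "expr_defined P as (P ! i)"
    and "expr_val P as (P ! i) = v" "expr_cost P as (P ! i) \<le> T"
  shows "computes P i as v T"
proof -
  have "returns P i as v (expr_cost P as (P ! i))"
    using assms evaluates_expr_val unfolding returns_def by blast
  then show ?thesis
    using returns_unique[of P i as v] assms(4) unfolding computes_def halts_def by auto
qed

lemma computes_mono: "computes P i as v T \<Longrightarrow> T \<le> T' \<Longrightarrow> computes P i as v T'"
  unfolding computes_def by simp

abbreviation sTrue :: expr where "sTrue \<equiv> Cell Empty Empty"

definition truth :: "bool \<Rightarrow> sexp" where "truth b = (if b then Dot Atom Atom else Atom)"

lemma truth_eq_Atom [simp]: "truth b = Atom \<longleftrightarrow> \<not> b" "Atom = truth b \<longleftrightarrow> \<not> b"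
  by (simp_all add: truth_def)

lemma truth_simps [simp]: "truth True = Dot Atom Atom" "truth False = Atom"
  by (simp_all add: truth_def)

section \<open>The program\<close>

text \<open>A variable of a state is encoded as \<open>Dot e x\<close>, where \<open>e\<close> is the adjacency list entry of a left
  vertex \<open>u\<close> and \<open>x\<close> is the name of a vertex of the bag. If \<open>x\<close> is a neighbor of \<open>u\<close>, the variable
  means that \<open>u\<close> is matched to \<open>x\<close>; if \<open>x\<close> is \<open>u\<close> itself, it means that the partner of \<open>u\<close> has not been
  forgotten. A state is the list of its true variables, and numbers that are only counted are unary,
  that is, lengths of lists.\<close>

definition "MAIN = (0::nat)"
definition "EQ = (1::nat)"
definition "MEM = (2::nat)"
definition "SEL = (3::nat)"
definition "HALF = (4::nat)"
definition "LEQ = (5::nat)"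
definition "SUB = (6::nat)"
definition "FAIRC = (7::nat)"
definition "FAIR = (8::nat)"
definition "VARS = (9::nat)"
definition "BAGVARS = (10::nat)"
definition "LOOK = (11::nat)"
definition "JOIN = (12::nat)"
definition "FORGETV = (13::nat)"
definition "FORGETU = (14::nat)"
definition "INTRO = (15::nat)"
definition "DIFF = (16::nat)"
definition "STEP = (17::nat)"
definition "CHECK = (18::nat)"
definition "BUILD = (19::nat)"
definition "SOLVE = (20::nat)"

definition main_body :: expr where
  "main_body =
    Call SOLVE [Fst (Var 0), Snd (Var 0)]"

definition eq_body :: expr where
  "eq_body =
    IfPair (Var 0)
      (IfPair (Var 1)
        (IfPair (Call EQ [Fst (Var 0), Fst (Var 1)]) (Call EQ [Snd (Var 0), Snd (Var 1)]) Empty)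
        Empty)
      (IfPair (Var 1) Empty sTrue)"

definition mem_body :: expr where
  "mem_body =
    IfPair (Var 1)
      (IfPair (Call EQ [Var 0, Fst (Var 1)]) sTrue (Call MEM [Var 0, Snd (Var 1)]))
      Empty"

text \<open>Lookup by first component, returning all matches. It extracts color classes, finds
  entries and thresholds, decides whether a vertex is on the left, and lists the true variables of a
  left vertex.\<close>

definition sel_body :: expr where
  "sel_body =
    IfPair (Var 1)
      (IfPair (Call EQ [Var 0, Fst (Fst (Var 1))])
        (Cell (Fst (Var 1)) (Call SEL [Var 0, Snd (Var 1)]))
        (Call SEL [Var 0, Snd (Var 1)]))
      Empty"

definition half_body :: expr where
  "half_body =
    IfPair (Var 0) (Cell Empty (Call HALF [Snd (Snd (Var 0))])) Empty"

text \<open>Compares a unary number \<open>d\<close> with a binary one. For nonzero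
  \<open>d\<close>, \<open>d \<le> 2 m\<close> holds iff half of \<open>d\<close>, rounded up, is at
  most \<open>m\<close>, and \<open>d \<le> 2 m + 1\<close> iff this holds for \<open>d - 1\<close>.
  The threshold stays binary because it may be exponential in the input size.\<close>

definition leq_body :: expr where
  "leq_body =
    IfPair (Var 0)
      (IfPair (Var 1)
        (Call LEQ [Call HALF [IfPair (Fst (Var 1)) (Snd (Var 0)) (Var 0)], Snd (Var 1)])
        Empty)
      sTrue"

definition sub_body :: expr where
  "sub_body =
    IfPair (Var 1) (Call SUB [Snd (Var 0), Snd (Var 1)]) (Var 0)"

definition fairc_body :: expr where
  "fairc_body =
    IfPair (Var 1)
      (IfPair (Call LEQ [Call SUB [Call SEL [Var 0, Var 2], Call SEL [Fst (Var 1), Var 2]], Var 3])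
        (Call FAIRC [Var 0, Snd (Var 1), Var 2, Var 3])
        Empty)
      sTrue"

definition fair_body :: expr where
  "fair_body =
    IfPair (Var 0)
      (IfPair (Call FAIRC [Fst (Var 0), Var 1, Var 2, Var 3])
        (Call FAIR [Snd (Var 0), Var 1, Var 2, Var 3])
        Empty)
      sTrue"

definition vars_body :: expr where
  "vars_body =
    IfPair (Var 1)
      (IfPair (Call MEM [Var 0, Cell (Fst (Fst (Var 1))) (Fst (Snd (Snd (Fst (Var 1)))))])
        (Cell (Cell (Fst (Var 1)) (Var 0)) (Call VARS [Var 0, Snd (Var 1), Var 2]))
        (Call VARS [Var 0, Snd (Var 1), Var 2]))
      (Var 2)"

definition bagvars_body :: expr where
  "bagvars_body =
    IfPair (Var 0)
      (Call VARS [Fst (Var 0), Var 1, Call BAGVARS [Snd (Var 0), Var 1]])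
      Empty"

text \<open>The second component of a table is the branch in which its first variable is
  true.\<close>

definition look_body :: expr where
  "look_body =
    IfPair (Var 0)
      (Call LOOK [Snd (Var 0), Var 1,
        IfPair (Call MEM [Fst (Var 0), Var 1]) (Snd (Var 2)) (Fst (Var 2))])
      (IfPair (Var 2) sTrue Empty)"

text \<open>A false \<open>(u, u)\<close> says that the partner of \<open>u\<close> is forgotten.
  This happened below one child only, so the variable is true in the state of the other child. All
  remaining variables have the same value in both.\<close>

definition join_body :: expr where
  "join_body =
    IfPair (Var 0)
      (IfPair (Call MEM [Fst (Var 0), Var 1])
        (Call JOIN [Snd (Var 0), Var 1, Snd (Var 2), Snd (Var 3)])
        (IfPair (Call EQ [Fst (Fst (Fst (Var 0))), Snd (Fst (Var 0))])
          (IfPair (Call JOIN [Snd (Var 0), Var 1, Snd (Var 2), Fst (Var 3)])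
            sTrue
            (Call JOIN [Snd (Var 0), Var 1, Fst (Var 2), Snd (Var 3)]))
          (Call JOIN [Snd (Var 0), Var 1, Fst (Var 2), Fst (Var 3)])))
      (IfPair (Var 2) (IfPair (Var 3) sTrue Empty) Empty)"

text \<open>Backtracking over the candidate partners \<open>u\<close> of the forgotten
  \<open>x\<close>. If \<open>(u, u)\<close> is true, the partner of \<open>u\<close> is not
  forgotten and cannot be \<open>x\<close>. In the state of the child \<open>x\<close> is still in
  the bag, so choosing \<open>u\<close> makes \<open>(u, u)\<close> true along with
  \<open>(u, x)\<close>.\<close>

definition forgetv_body :: expr where
  "forgetv_body =
    IfPair (Var 0)
      (IfPair (Call FORGETV [Snd (Var 0), Var 1, Var 2, Var 3, Var 4, Var 5, Var 6])
        sTrue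
        (IfPair (Call MEM [Cell (Fst (Fst (Var 0))) (Fst (Fst (Fst (Var 0)))), Var 2])
          Empty
          (Call FORGETV [Snd (Var 0), Cell (Snd (Fst (Fst (Var 0)))) (Var 1),
            Cell (Cell (Fst (Fst (Var 0))) (Fst (Fst (Fst (Var 0))))) (Cell (Fst (Var 0)) (Var 2)),
            Var 3, Var 4, Var 5, Var 6])))
      (IfPair (Call FAIR [Var 4, Var 4, Var 1, Var 3]) (Call LOOK [Var 5, Var 2, Var 6]) Empty)"

text \<open>The variables of the forgotten \<open>u\<close> in the state are edges to right vertices
  of the bag. If there is none, the partner was forgotten and \<open>(u, u)\<close> is false in the
  child; if there is one, \<open>(u, u)\<close> is true; two or more are inconsistent.\<close>

definition forgetu_body :: expr where
  "forgetu_body =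
    IfPair (Call SEL [Fst (Var 0), Var 1])
      (IfPair (Snd (Call SEL [Fst (Var 0), Var 1]))
        Empty
        (Call LOOK [Var 2, Cell (Var 0) (Var 1), Var 3]))
      (Call LOOK [Var 2, Var 1, Var 3])"

definition intro_body :: expr where
  "intro_body =
    IfPair (Call SEL [Var 0, Var 1])
      (IfPair (Call MEM [Cell (Fst (Call SEL [Var 0, Var 1])) (Var 0), Var 2])
        (Call LOOK [Var 3, Var 2, Var 4])
        Empty)
      (Call LOOK [Var 3, Var 2, Var 4])"

text \<open>Not a full difference: the search stops at the first element outside the second list.
  The bags at an introduce or forget node differ in one vertex, which is then the head.\<close>

definition diff_body :: expr where
  "diff_body =
    IfPair (Var 0)
      (IfPair (Call MEM [Fst (Var 0), Var 1]) (Call DIFF [Snd (Var 0), Var 1]) (Var 0))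
      Empty"

text \<open>A nonempty first difference identifies an introduce node. The side of a forgotten vertex
  is found by searching for its entry among the left vertices.\<close>

definition step_body :: expr where
  "step_body =
    IfPair (Var 2)
      (Call INTRO [Fst (Var 2), Fst (Var 1), Var 0, Var 4, Var 5])
      (IfPair (Call SEL [Fst (Var 3), Fst (Var 1)])
        (Call FORGETU
          [Cell (Fst (Call SEL [Fst (Var 3), Fst (Var 1)])) (Fst (Var 3)), Var 0, Var 4, Var 5])
        (Call FORGETV [Call VARS [Fst (Var 3), Fst (Var 1), Empty], Empty, Var 0,
          Fst (Snd (Fst (Call SEL [Fst (Var 3), Fst (Snd (Var 1))]))),
          Fst (Snd (Snd (Var 1))), Var 4, Var 5]))"

definition check_body :: expr where
  "check_body =
    IfPair (Snd (Var 3))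
      (Call JOIN [Call BAGVARS [Var 2, Fst (Var 1)], Var 0, Var 4, Var 5])
      (Call STEP [Var 0, Var 1, Call DIFF [Var 2, Fst (Fst (Var 3))],
        Call DIFF [Fst (Fst (Var 3)), Var 2], Call BAGVARS [Fst (Fst (Var 3)), Fst (Var 1)], Var 4])"

definition build_body :: expr where
  "build_body =
    IfPair (Var 0)
      (Cell
        (Call BUILD [Snd (Var 0), Var 1, Var 2, Var 3, Var 4, Var 5, Var 6])
        (Call BUILD [Snd (Var 0), Cell (Fst (Var 0)) (Var 1), Var 2, Var 3, Var 4, Var 5, Var 6]))
      (Call CHECK [Var 1, Var 2, Var 3, Var 4, Var 5, Var 6])"

text \<open>A leaf has no variables, so its table is a single true value. At a node with one child
  the second recursive call gets an atom and returns a dummy. Arguments are evaluated before the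
  call, so each child table is computed once for all states.\<close>

definition solve_body :: expr where
  "solve_body =
    IfPair (Snd (Var 1))
      (Call BUILD [Call BAGVARS [Fst (Var 1), Fst (Var 0)], Empty, Var 0, Fst (Var 1), Snd (Var 1),
        Call SOLVE [Var 0, Fst (Snd (Var 1))], Call SOLVE [Var 0, Fst (Snd (Snd (Var 1)))]])
      sTrue"

definition prog :: program where
  "prog = [main_body, eq_body, mem_body, sel_body, half_body, leq_body, sub_body, fairc_body,
    fair_body, vars_body, bagvars_body, look_body, join_body, forgetv_body, forgetu_body,
    intro_body, diff_body, step_body, check_body, build_body, solve_body]"

abbreviation runs :: "nat \<Rightarrow> sexp list \<Rightarrow> sexp \<Rightarrow> nat \<Rightarrow> bool" where
  "runs \<equiv> computes prog"

lemmas function_defs = MAIN_def EQ_def MEM_def SEL_def HALF_def LEQ_def SUB_def FAIRC_def FAIR_def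
  VARS_def BAGVARS_def LOOK_def JOIN_def FORGETV_def FORGETU_def INTRO_def DIFF_def STEP_def
  CHECK_def BUILD_def SOLVE_def

lemma prog_nth [simp]:
  "prog ! MAIN = main_body"
  "prog ! EQ = eq_body"
  "prog ! MEM = mem_body"
  "prog ! SEL = sel_body"
  "prog ! HALF = half_body"
  "prog ! LEQ = leq_body"
  "prog ! SUB = sub_body"
  "prog ! FAIRC = fairc_body"
  "prog ! FAIR = fair_body"
  "prog ! VARS = vars_body"
  "prog ! BAGVARS = bagvars_body"
  "prog ! LOOK = look_body"
  "prog ! JOIN = join_body"
  "prog ! FORGETV = forgetv_body"
  "prog ! FORGETU = forgetu_body"
  "prog ! INTRO = intro_body"
  "prog ! DIFF = diff_body"
  "prog ! STEP = step_body"
  "prog ! CHECK = check_body"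
  "prog ! BUILD = build_body"
  "prog ! SOLVE = solve_body"
  unfolding prog_def by (simp_all add: function_defs)

lemma less_length_prog [simp]:
  "MAIN < length prog"
  "EQ < length prog"
  "MEM < length prog"
  "SEL < length prog"
  "HALF < length prog"
  "LEQ < length prog"
  "SUB < length prog"
  "FAIRC < length prog"
  "FAIR < length prog"
  "VARS < length prog"
  "BAGVARS < length prog"
  "LOOK < length prog"
  "JOIN < length prog"
  "FORGETV < length prog"
  "FORGETU < length prog"
  "INTRO < length prog"
  "DIFF < length prog"
  "STEP < length prog"
  "CHECK < length prog"
  "BUILD < length prog"
  "SOLVE < length prog"
  unfolding prog_def by (simp_all add: function_defs)

section \<open>Values and costs of the functions of the program\<close>

lemma EQ_runs: "runs EQ [a, b] (truth (a = b)) (40 * size a + 20)"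
proof (induction a arbitrary: b)
  case Atom
  show ?case by (rule computesI) (cases b; simp add: eq_body_def)+
next
  case (Dot a1 a2)
  show ?case
    using Dot[of "sfst b"] Dot[of "ssnd b"]
    by (intro computesI) (cases b; auto simp: eq_body_def computes_def)+
qed

lemma enc_list_simps [simp]:
  "enc_list [] = Atom" "enc_list (x # xs) = Dot x (enc_list xs)"
  by (simp_all add: enc_list_def)

lemma MEM_runs: "runs MEM [x, enc_list L] (truth (x \<in> set L)) ((length L + 1) * (40 * size x + 50))"
proof (induction L)
  case Nil
  show ?case by (rule computesI) (simp_all add: mem_body_def)
next
  case (Cons a L)
  show ?case
    using Cons EQ_runs[of x a]
    by (intro computesI) (auto simp: mem_body_def computes_def)
qed

lemma SEL_runs:
  "runs SEL [k, enc_list L] (enc_list (filter (\<lambda>z. sfst z = k) L)) ((length L + 1) * (40 * size k + 60))"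
proof (induction L)
  case Nil
  show ?case by (rule computesI) (simp_all add: sel_body_def)
next
  case (Cons a L)
  show ?case
    using Cons EQ_runs[of k "sfst a"]
    by (intro computesI) (auto simp: sel_body_def computes_def)
qed

text \<open>A unary number matters only through its length, so the resulting list stays
  existentially quantified.\<close>

lemma HALF_runs:
  "\<exists>h. length h = (length d + 1) div 2 \<and> runs HALF [enc_list d] (enc_list h) ((length d + 1) * 10)"
proof (induction d rule: induct_list012)
  case 1
  have "runs HALF [enc_list []] (enc_list []) 10"
    by (rule computesI) (simp_all add: half_body_def)
  then show ?case by auto
next
  case (2 x)
  have "runs HALF [enc_list []] (enc_list []) 10"
    by (rule computesI) (simp_all add: half_body_def)
  then have "runs HALF [enc_list [x]] (enc_list [Atom]) 20"
    by (intro computesI) (auto simp: half_body_def computes_def)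
  then show ?case by (intro exI[of _ "[Atom]"]) simp
next
  case (3 x y d)
  then obtain h where h: "length h = (length d + 1) div 2"
    "runs HALF [enc_list d] (enc_list h) ((length d + 1) * 10)" by blast
  then have "runs HALF [enc_list (x # y # d)] (enc_list (Atom # h)) ((length (x # y # d) + 1) * 10)"
    by (intro computesI) (auto simp: half_body_def computes_def)
  then show ?case using h by (intro exI[of _ "Atom # h"]) simp
qed

lemma SUB_runs:
  "runs SUB [enc_list a, enc_list b] (enc_list (drop (length b) a)) ((length b + 1) * 10)"
proof (induction b arbitrary: a)
  case Nil
  show ?case by (rule computesI) (simp_all add: sub_body_def)
next
  case (Cons x b)
  show ?case
    using Cons[of "tl a"]
    by (intro computesI) (cases a; auto simp: sub_body_def computes_def)+
qed

lemma enc_nat_eq_Atom [simp]: "enc_nat n = Atom \<longleftrightarrow> n = 0"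
  by (subst enc_nat.simps) simp

lemma sfst_enc_nat: "sfst (enc_nat n) = truth (odd n)"
  by (subst enc_nat.simps) simp

lemma ssnd_enc_nat: "ssnd (enc_nat n) = enc_nat (n div 2)"
  by (subst enc_nat.simps) (simp add: enc_nat.simps)

lemma inj_enc_nat: "inj enc_nat"
proof (rule injI)
  show "enc_nat m = enc_nat n \<Longrightarrow> m = n" for m n
  proof (induction m arbitrary: n rule: less_induct)
    case (less m)
    show ?case
    proof (cases "m = 0")
      case True
      then show ?thesis using less.prems by (metis enc_nat_eq_Atom)
    next
      case False
      then have "n \<noteq> 0" using less.prems by (metis enc_nat_eq_Atom)
      have "truth (odd m) = truth (odd n)" "enc_nat (m div 2) = enc_nat (n div 2)"
        using less.prems by (metis sfst_enc_nat, metis ssnd_enc_nat)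
      then have "odd m = odd n" "m div 2 = n div 2"
        using False by (auto simp: truth_def less.IH split: if_splits)
      then show ?thesis by (metis even_two_times_div_two odd_two_times_div_two_succ)
    qed
  qed
qed

lemma enc_nat_inject [simp]: "enc_nat m = enc_nat n \<longleftrightarrow> m = n"
  using inj_enc_nat by (auto dest: injD)

lemma size_enc_nat: "n > 0 \<Longrightarrow> size (enc_nat (n div 2)) < size (enc_nat n)"
  by (subst (2) enc_nat.simps) simp

text \<open>Each call consumes one bit of \<open>l\<close>, so the size of its encoding pays for the
  recursion, and the halved lists never exceed \<open>k\<close>.\<close>

lemma LEQ_runs:
  "length d \<le> k \<Longrightarrow> runs LEQ [enc_list d, enc_nat l] (truth (length d \<le> l))
     ((size (enc_nat l) + 1) * (10 * k + 30))"
proof (induction l arbitrary: d rule: less_induct)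
  case (less l)
  show ?case
  proof (cases "d = [] \<or> l = 0")
    case True
    then show ?thesis
      by (intro computesI) (cases d; auto simp: leq_body_def computes_def enc_nat.simps[of 0])+
  next
    case False
    then have l: "l > 0" by simp
    \<comment> \<open>An odd \<open>l\<close> spends its last bit on one element of
      \<open>d\<close>; afterwards both sides can be halved.\<close>
    define e where "e = (if odd l then tl d else d)"
    have e: "enc_list e = (if odd l then ssnd (enc_list d) else enc_list d)" "length e \<le> k"
      using False less.prems by (cases d; auto simp: e_def)+
    obtain h where h: "length h = (length e + 1) div 2"
      "runs HALF [enc_list e] (enc_list h) ((length e + 1) * 10)" using HALF_runs by blast
    have "length h \<le> k" using h(1) e(2) by (cases e) auto
    then have *: "runs LEQ [enc_list h, enc_nat (l div 2)] (truth (length h \<le> l div 2))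
      ((size (enc_nat (l div 2)) + 1) * (10 * k + 30))"
      using l by (intro less.IH) auto
    have "length h \<le> l div 2 \<longleftrightarrow> length d \<le> l"
      using h(1) False by (cases d) (auto simp: e_def; presburger)+
    moreover have "(size (enc_nat (l div 2)) + 1) * (10 * k + 30) + (10 * k + 30) \<le>
      (size (enc_nat l) + 1) * (10 * k + 30)"
      using mult_le_mono1[of "size (enc_nat (l div 2)) + 2" "size (enc_nat l) + 1" "10 * k + 30"]
        size_enc_nat[OF l] by (simp add: algebra_simps)
    ultimately show ?thesis
      using h * e False
      by (intro computesI)
        (cases d; auto simp: leq_body_def computes_def sfst_enc_nat ssnd_enc_nat split: if_splits)+
  qed
qed

definition "mem_cost k = (k + 1) * (40 * k + 50 :: nat)"
definition "sel_cost k = (k + 1) * (40 * k + 60 :: nat)"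
definition "fairc_cost k = 2 * sel_cost k + (k + 1) * (10 * k + 40 :: nat) + 30"
definition "fair_cost k = (k + 1) * ((k + 1) * fairc_cost k + 20)"
definition "vars_cost k = (k + 1) * (mem_cost k + 40)"
definition "bagvars_cost k = (k + 1) * (vars_cost k + 20)"
definition "look_cost k = (k + 1) * (mem_cost k + 20)"

lemma MEM_runs_le:
  "length L \<le> k \<Longrightarrow> size x \<le> k \<Longrightarrow> runs MEM [x, enc_list L] (truth (x \<in> set L)) (mem_cost k)"
  by (rule computes_mono[OF MEM_runs]) (unfold mem_cost_def, intro mult_le_mono, auto)

lemma SEL_runs_le:
  "length L \<le> n \<Longrightarrow> size k \<le> n \<Longrightarrow>
   runs SEL [k, enc_list L] (enc_list (filter (\<lambda>z. sfst z = k) L)) (sel_cost n)"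
  by (rule computes_mono[OF SEL_runs]) (unfold sel_cost_def, intro mult_le_mono, auto)

lemma LEQ_runs_le:
  "length d \<le> k \<Longrightarrow> size (enc_nat l) \<le> k \<Longrightarrow>
   runs LEQ [enc_list d, enc_nat l] (truth (length d \<le> l)) ((k + 1) * (10 * k + 30))"
  by (rule computes_mono[OF LEQ_runs[of d k]]) auto

text \<open>Bounding the differences over all ordered pairs spares the program a maximum and a
  minimum; truncated subtraction makes the pairs in the wrong order harmless.\<close>

lemma fair_iff:
  assumes "finite C" "C \<noteq> {}"
  shows "fair C f l S \<longleftrightarrow> (\<forall>c\<in>C. \<forall>c'\<in>C. color_count f S c - color_count f S c' \<le> l)"
proof -
  let ?A = "color_count f S ` C"
  have fin: "finite ?A" "?A \<noteq> {}" using assms by auto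
  show ?thesis
  proof
    assume *: "fair C f l S"
    show "\<forall>c\<in>C. \<forall>c'\<in>C. color_count f S c - color_count f S c' \<le> l"
    proof (intro ballI)
      fix c c' assume "c \<in> C" "c' \<in> C"
      then have "color_count f S c \<le> Max ?A" "Min ?A \<le> color_count f S c'"
        using fin by auto
      then show "color_count f S c - color_count f S c' \<le> l"
        using * unfolding fair_def by linarith
    qed
  next
    assume *: "\<forall>c\<in>C. \<forall>c'\<in>C. color_count f S c - color_count f S c' \<le> l"
    obtain c c' where "c \<in> C" "c' \<in> C" "Max ?A = color_count f S c" "Min ?A = color_count f S c'"
      using Max_in[OF fin] Min_in[OF fin] by auto
    then show "fair C f l S" using * unfolding fair_def by simp
  qed
qed

lemma color_count_set:
  "distinct us \<Longrightarrow> color_count f (set us) c = length (filter (\<lambda>u. f u = c) us)"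
  unfolding color_count_def by (metis distinct_card distinct_filter set_filter)

text \<open>The set \<open>A\<close> collects the variables chosen on the path from the root.\<close>

fun trie :: "'a list \<Rightarrow> ('a set \<Rightarrow> bool) \<Rightarrow> 'a set \<Rightarrow> sexp" where
  "trie [] \<Phi> A = truth (\<Phi> A)"
| "trie (v # vs) \<Phi> A = Dot (trie vs \<Phi> A) (trie vs \<Phi> (insert v A))"

section \<open>Encoded vertices, colors and variables of a fixed instance\<close>

locale valid_fair_instance =
  fixes I :: "(nat, nat) fair_instance"
  assumes valid: "valid_instance I"
begin

abbreviation adj :: "nat \<Rightarrow> nat set" where "adj \<equiv> nbrs (edges I)"

definition entry :: "nat \<Rightarrow> sexp" where
  "entry u = enc_list [enc_nat u, enc_nat (col I u), enc_set (adj u)]"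

definition enc_var :: "nat \<times> nat \<Rightarrow> sexp" where
  "enc_var p = Dot (entry (fst p)) (enc_nat (snd p))"

definition incident :: "nat \<Rightarrow> nat \<Rightarrow> bool" where
  "incident u x \<longleftrightarrow> x = u \<or> x \<in> adj u"

definition vars_in :: "nat list \<Rightarrow> nat \<Rightarrow> (nat \<times> nat) list" where
  "vars_in us x = map (\<lambda>u. (u, x)) (filter (\<lambda>u. incident u x) us)"

lemma finite_bipartition: "finite (left I)" "finite (right I)" "left I \<inter> right I = {}"
  using valid unfolding valid_instance_def bipartite_graph_def by auto

lemma finite_colors: "finite (colors I)" "colors I \<noteq> {}"
  using valid unfolding valid_instance_def by auto

lemma edge_cases: "{x, y} \<in> edges I \<Longrightarrow> x \<in> left I \<and> y \<in> right I \<or> y \<in> left I \<and> x \<in> right I"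
  using valid unfolding valid_instance_def bipartite_graph_def by (metis doubleton_eq_iff)

lemma adj_left: "u \<in> left I \<Longrightarrow> adj u \<subseteq> right I"
  using edge_cases finite_bipartition(3) unfolding nbrs_def by blast

lemma adj_right: "v \<in> right I \<Longrightarrow> adj v = {u \<in> left I. v \<in> adj u}"
  using edge_cases finite_bipartition(3) unfolding nbrs_def by (auto simp: insert_commute)

lemma finite_adj: "u \<in> left I \<Longrightarrow> finite (adj u)"
  using adj_left finite_bipartition finite_subset by metis

lemma entry_simps [simp]:
  "sfst (entry u) = enc_nat u" "sfst (ssnd (entry u)) = enc_nat (col I u)"
  "sfst (ssnd (ssnd (entry u))) = enc_set (adj u)" "entry u \<noteq> Atom"
  by (simp_all add: entry_def)

lemma entry_inject [simp]: "entry u = entry u' \<longleftrightarrow> u = u'"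
  by (metis enc_nat_inject entry_simps(1))

lemma enc_var_simps [simp]:
  "sfst (enc_var p) = entry (fst p)" "ssnd (enc_var p) = enc_nat (snd p)" "enc_var p \<noteq> Atom"
  by (simp_all add: enc_var_def)

lemma enc_var_inject [simp]: "enc_var p = enc_var q \<longleftrightarrow> p = q"
  by (auto simp: enc_var_def prod_eq_iff)

lemma enc_var_in_image [simp]: "enc_var p \<in> enc_var ` A \<longleftrightarrow> p \<in> A"
  by auto

lemma Dot_entry: "Dot (entry u) (enc_nat x) = enc_var (u, x)"
  by (simp add: enc_var_def)

text \<open>Dropping the name of a vertex puts its color first, so that \<open>SEL\<close> with a
  color as key yields a color class.\<close>

abbreviation enc_items :: "nat list \<Rightarrow> sexp" where
  "enc_items us \<equiv> enc_list (map (\<lambda>u. ssnd (entry u)) us)"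

abbreviation count :: "nat list \<Rightarrow> nat \<Rightarrow> nat" where
  "count us c \<equiv> length (filter (\<lambda>u. col I u = c) us)"

lemma SEL_items:
  assumes "length us \<le> k" "size (enc_nat c) \<le> k"
  shows "runs SEL [enc_nat c, enc_items us] (enc_items (filter (\<lambda>u. col I u = c) us)) (sel_cost k)"
proof -
  have "filter (\<lambda>z. sfst z = enc_nat c) (map (\<lambda>u. ssnd (entry u)) us) =
    map (\<lambda>u. ssnd (entry u)) (filter (\<lambda>u. col I u = c) us)"
    by (induction us) auto
  then show ?thesis
    using SEL_runs_le[of "map (\<lambda>u. ssnd (entry u)) us" k "enc_nat c"] assms by simp
qed

lemma FAIRC_runs:
  assumes "length us \<le> k" "size (enc_nat c) \<le> k" "size (enc_nat l) \<le> k"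
    and "\<forall>c\<in>set cs. size (enc_nat c) \<le> k"
  shows "runs FAIRC [enc_nat c, enc_list (map enc_nat cs), enc_items us, enc_nat l]
    (truth (\<forall>c'\<in>set cs. count us c - count us c' \<le> l)) ((length cs + 1) * fairc_cost k)"
  using assms(4)
proof (induction cs)
  case Nil
  show ?case by (rule computesI) (simp_all add: fairc_body_def fairc_cost_def)
next
  case (Cons c' cs)
  let ?d = "drop (count us c') (map (\<lambda>u. ssnd (entry u)) (filter (\<lambda>u. col I u = c) us))"
  have sel: "runs SEL [enc_nat c, enc_items us] (enc_items (filter (\<lambda>u. col I u = c) us)) (sel_cost k)"
    "runs SEL [enc_nat c', enc_items us] (enc_items (filter (\<lambda>u. col I u = c') us)) (sel_cost k)"
    using SEL_items assms Cons.prems by auto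
  have "count us c' \<le> k" using assms(1) le_trans length_filter_le by blast
  then have sub: "runs SUB [enc_items (filter (\<lambda>u. col I u = c) us),
      enc_items (filter (\<lambda>u. col I u = c') us)] (enc_list ?d) ((k + 1) * 10)"
    using computes_mono[OF SUB_runs[of "map (\<lambda>u. ssnd (entry u)) (filter (\<lambda>u. col I u = c) us)"
      "map (\<lambda>u. ssnd (entry u)) (filter (\<lambda>u. col I u = c') us)"], of "(k + 1) * 10"] by simp
  have "count us c \<le> k" using assms(1) le_trans length_filter_le by blast
  then have leq: "runs LEQ [enc_list ?d, enc_nat l] (truth (count us c - count us c' \<le> l))
      ((k + 1) * (10 * k + 30))"
    using LEQ_runs_le[of ?d k l] assms by (simp add: drop_map)
  show ?case
    using sel sub leq Cons
    by (intro computesI) (auto simp: fairc_body_def computes_def fairc_cost_def algebra_simps)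
qed

lemma FAIR_runs:
  assumes "length us \<le> k" "size (enc_nat l) \<le> k"
    and "\<forall>c\<in>set cs. size (enc_nat c) \<le> k" "\<forall>c\<in>set ds. size (enc_nat c) \<le> k" "length cs \<le> k"
  shows "runs FAIR [enc_list (map enc_nat ds), enc_list (map enc_nat cs), enc_items us, enc_nat l]
    (truth (\<forall>c\<in>set ds. \<forall>c'\<in>set cs. count us c - count us c' \<le> l))
    ((length ds + 1) * ((k + 1) * fairc_cost k + 20))"
  using assms(4)
proof (induction ds)
  case Nil
  show ?case by (rule computesI) (simp_all add: fair_body_def)
next
  case (Cons c ds)
  have "runs FAIRC [enc_nat c, enc_list (map enc_nat cs), enc_items us, enc_nat l]
    (truth (\<forall>c'\<in>set cs. count us c - count us c' \<le> l)) ((k + 1) * fairc_cost k)"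
    using Cons.prems assms by (intro computes_mono[OF FAIRC_runs]) auto
  then show ?case
    using Cons by (intro computesI) (auto simp: fair_body_def computes_def)
qed

lemma FAIR_runs_set:
  assumes "length us \<le> k" "size (enc_nat l) \<le> k" "distinct us"
    and "\<forall>c\<in>colors I. size (enc_nat c) \<le> k" "card (colors I) \<le> k"
  shows "runs FAIR [enc_set (colors I), enc_set (colors I), enc_items us, enc_nat l]
    (truth (fair (colors I) (col I) l (set us))) (fair_cost k)"
proof -
  let ?cs = "sorted_list_of_set (colors I)"
  have "runs FAIR [enc_list (map enc_nat ?cs), enc_list (map enc_nat ?cs), enc_items us, enc_nat l]
    (truth (\<forall>c\<in>set ?cs. \<forall>c'\<in>set ?cs. count us c - count us c' \<le> l)) (fair_cost k)"
    using assms finite_colors unfolding fair_cost_def by (intro computes_mono[OF FAIR_runs]) auto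
  then show ?thesis
    using finite_colors
    by (simp add: enc_set_def fair_iff[OF finite_colors] color_count_set[OF assms(3)])
qed

lemma VARS_runs:
  assumes "set us \<subseteq> left I" "size (enc_nat x) \<le> k" "\<forall>u\<in>set us. card (adj u) < k"
  shows "runs VARS [enc_nat x, enc_list (map entry us), enc_list acc]
    (enc_list (map enc_var (vars_in us x) @ acc)) ((length us + 1) * (mem_cost k + 40))"
  using assms(1,3)
proof (induction us)
  case Nil
  show ?case by (rule computesI) (simp_all add: vars_body_def vars_in_def)
next
  case (Cons u us)
  \<comment> \<open>The list searched has the name of \<open>u\<close> in front of its neighbors,
    one element more than the degree; hence the strict bound on \<open>card (adj u)\<close>.\<close>
  let ?N = "map enc_nat (u # sorted_list_of_set (adj u))"
  have "x \<in> set (u # sorted_list_of_set (adj u)) \<longleftrightarrow> incident u x"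
    using Cons.prems finite_adj by (auto simp: incident_def)
  then have "runs MEM [enc_nat x, enc_list ?N] (truth (incident u x)) (mem_cost k)"
    using MEM_runs_le[of ?N k "enc_nat x"] assms(2) Cons.prems by (auto simp: image_iff)
  then show ?case
    using Cons by (intro computesI)
      (auto simp: vars_body_def computes_def vars_in_def enc_var_def enc_set_def)
qed

lemma BAGVARS_runs:
  assumes "set us \<subseteq> left I" "length us \<le> k" "\<forall>u\<in>set us. card (adj u) < k"
    and "\<forall>x\<in>set xs. size (enc_nat x) \<le> k"
  shows "runs BAGVARS [enc_list (map enc_nat xs), enc_list (map entry us)]
    (enc_list (map enc_var (concat (map (vars_in us) xs)))) ((length xs + 1) * (vars_cost k + 20))"
  using assms(4)
proof (induction xs)
  case Nil
  show ?case by (rule computesI) (simp_all add: bagvars_body_def)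
next
  case (Cons x xs)
  have "runs VARS [enc_nat x, enc_list (map entry us),
      enc_list (map enc_var (concat (map (vars_in us) xs)))]
    (enc_list (map enc_var (vars_in us x) @ map enc_var (concat (map (vars_in us) xs)))) (vars_cost k)"
    using Cons.prems assms unfolding vars_cost_def
    by (intro computes_mono[OF VARS_runs]) auto
  then show ?case
    using Cons by (intro computesI) (auto simp: bagvars_body_def computes_def)
qed

lemma MEM_var:
  "length s \<le> k \<Longrightarrow> size (enc_var p) \<le> k \<Longrightarrow>
   runs MEM [enc_var p, enc_list (map enc_var s)] (truth (p \<in> set s)) (mem_cost k)"
  using MEM_runs_le[of "map enc_var s" k "enc_var p"] by simp

text \<open>Variables of \<open>s\<close> outside \<open>vs\<close> are never asked for, so a lookup
  restricts a state to the bag of the table at no cost.\<close>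

lemma LOOK_runs:
  assumes "length s \<le> k" "\<forall>p\<in>set vs. size (enc_var p) \<le> k"
  shows "runs LOOK [enc_list (map enc_var vs), enc_list (map enc_var s), trie vs \<Phi> A]
    (truth (\<Phi> (A \<union> set s \<inter> set vs))) ((length vs + 1) * (mem_cost k + 20))"
  using assms(2)
proof (induction vs arbitrary: A)
  case Nil
  show ?case by (rule computesI) (simp_all add: look_body_def truth_def)
next
  case (Cons p vs)
  have mem: "runs MEM [enc_var p, enc_list (map enc_var s)] (truth (p \<in> set s)) (mem_cost k)"
    using MEM_var assms Cons.prems by simp
  have eq: "A \<union> set s \<inter> set (p # vs) = (if p \<in> set s then insert p A else A) \<union> set s \<inter> set vs"
    by auto
  show ?case
    unfolding eq using mem Cons(1)[of A] Cons(1)[of "insert p A"] Cons(2)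
    by (intro computesI) (auto simp: look_body_def computes_def)
qed

lemma LOOK_runs_le:
  assumes "length s \<le> k" "length vs \<le> k" "\<forall>p\<in>set vs. size (enc_var p) \<le> k"
  shows "runs LOOK [enc_list (map enc_var vs), enc_list (map enc_var s), trie vs \<Phi> {}]
    (truth (\<Phi> (set s \<inter> set vs))) (look_cost k)"
  using computes_mono[OF LOOK_runs[OF assms(1,3), of \<Phi> "{}"], of "look_cost k"] assms(2)
  unfolding look_cost_def by simp

end

section \<open>One table entry computed from the tables of the children\<close>

lemma ex_subset_insert:
  "(\<exists>C\<subseteq>insert p D. P C) \<longleftrightarrow> (\<exists>C\<subseteq>D. P (insert p C)) \<or> (\<exists>C\<subseteq>D. P C)"
proof -
  have "C \<subseteq> insert p D \<longleftrightarrow> (\<exists>C'\<subseteq>D. C = insert p C') \<or> C \<subseteq> D" for C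
    by (metis insert_mono subset_insert subset_insertI2 subset_insert_iff insert_Diff)
  then show ?thesis by metis
qed

lemma filter_eq_singleton:
  "distinct xs \<Longrightarrow> filter (\<lambda>y. y = x) xs = (if x \<in> set xs then [x] else [])"
  by (induction xs) auto

definition "join_cost k = mem_cost k + 40 * k + (100 :: nat)"
definition "forgetv_cost k = fair_cost k + look_cost k + k * (mem_cost k + 80) + (40 :: nat)"
definition "forgetu_cost k = 2 * sel_cost k + look_cost k + (60 :: nat)"
definition "diff_cost k = (k + 1) * (mem_cost k + (20 :: nat))"
definition "step_cost k = forgetv_cost k + forgetu_cost k + 2 * sel_cost k + vars_cost k + mem_cost k + (100 :: nat)"
definition "check_cost k = bagvars_cost k + (k + 1) * join_cost k + 2 * diff_cost k + step_cost k + (60 :: nat)"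

context valid_fair_instance
begin

abbreviation enc_vars :: "(nat \<times> nat) list \<Rightarrow> sexp" where
  "enc_vars vs \<equiv> enc_list (map enc_var vs)"

lemma size_enc_var: "size (enc_nat (fst p)) \<le> size (enc_var p)" "size (entry (fst p)) \<le> size (enc_var p)"
  by (simp_all add: enc_var_def entry_def)

text \<open>Only the variables in \<open>D\<close> are true in exactly one of the two subtrees; the exponent of the cost
  counts the variables of this kind, not all variables of the bag.\<close>

lemma JOIN_runs:
  assumes "length s \<le> k" "\<forall>p\<in>set vs. size (enc_var p) \<le> k" "distinct vs"
  defines "D \<equiv> \<lambda>vs. {p \<in> set vs. fst p = snd p \<and> p \<notin> set s}"
  shows "runs JOIN [enc_vars vs, enc_vars s, trie vs \<Phi> A, trie vs \<Psi> B]
    (truth (\<exists>C\<subseteq>D vs. \<Phi> (A \<union> set s \<inter> set vs \<union> C) \<and> \<Psi> (B \<union> set s \<inter> set vs \<union> (D vs - C))))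
    (2 ^ length (filter (\<lambda>p. fst p = snd p) vs) * ((length vs + 1) * join_cost k))"
  using assms(2,3)
proof (induction vs arbitrary: A B)
  case Nil
  show ?case by (rule computesI) (simp_all add: join_body_def truth_def join_cost_def D_def)
next
  case (Cons p vs)
  have mem: "runs MEM [enc_var p, enc_vars s] (truth (p \<in> set s)) (mem_cost k)"
    using MEM_var assms(1) Cons.prems by simp
  have eq: "runs EQ [enc_nat (fst p), enc_nat (snd p)] (truth (fst p = snd p)) (40 * k + 20)"
    using computes_mono[OF EQ_runs[of "enc_nat (fst p)" "enc_nat (snd p)"], of "40 * k + 20"]
      size_enc_var(1)[of p] Cons.prems(1) by auto
  define N where "N = 2 ^ length (filter (\<lambda>p. fst p = snd p) vs) * ((length vs + 1) * join_cost k)"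
  define R where "R A B = (\<exists>C\<subseteq>D vs. \<Phi> (A \<union> set s \<inter> set vs \<union> C) \<and>
    \<Psi> (B \<union> set s \<inter> set vs \<union> (D vs - C)))" for A B
  have IH: "runs JOIN [enc_vars vs, enc_vars s, trie vs \<Phi> A, trie vs \<Psi> B] (truth (R A B)) N" for A B
    using Cons unfolding N_def R_def by simp
  have N: "2 ^ length (filter (\<lambda>p. fst p = snd p) (p # vs)) * ((length (p # vs) + 1) * join_cost k)
      \<ge> (if fst p = snd p then 2 * N else N) + join_cost k"
    unfolding N_def by (simp add: algebra_simps)
  have p: "p \<notin> set vs" "p \<notin> D vs" using Cons.prems by (auto simp: D_def)
  show ?case
  proof (cases "p \<in> set s")
    case True
    have *: "D (p # vs) = D vs" using True by (auto simp: D_def)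
    have "(\<exists>C\<subseteq>D (p # vs). \<Phi> (A \<union> set s \<inter> set (p # vs) \<union> C) \<and>
      \<Psi> (B \<union> set s \<inter> set (p # vs) \<union> (D (p # vs) - C))) = R (insert p A) (insert p B)"
      using True by (simp add: R_def * Un_insert_right)
    then show ?thesis
      using True mem IH[of "insert p A" "insert p B"] N
      by (intro computesI) (auto simp: join_body_def computes_def join_cost_def split: if_splits)
  next
    case False
    show ?thesis
    proof (cases "fst p = snd p")
      case True
      \<comment> \<open>Putting \<open>p\<close> into \<open>C\<close> makes it true in the first
        table, leaving it in the complement makes it true in the second: these are the two recursive
        calls.\<close>
      have *: "D (p # vs) = insert p (D vs)" using True False by (auto simp: D_def)
      have **: "insert p (D vs) - insert p C = D vs - C" "C \<subseteq> D vs \<Longrightarrow> insert p (D vs) - C = insert p (D vs - C)" for C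
        using p by auto
      have "(\<exists>C\<subseteq>D (p # vs). \<Phi> (A \<union> set s \<inter> set (p # vs) \<union> C) \<and>
        \<Psi> (B \<union> set s \<inter> set (p # vs) \<union> (D (p # vs) - C))) = (R (insert p A) B \<or> R A (insert p B))"
        using False by (auto simp: R_def * ex_subset_insert ** cong: conj_cong)
      then show ?thesis
        using True False mem eq IH[of "insert p A" B] IH[of A "insert p B"] N
        by (intro computesI) (auto simp: join_body_def computes_def join_cost_def)
    next
      case nD: False
      have *: "D (p # vs) = D vs" using nD by (auto simp: D_def)
      have "(\<exists>C\<subseteq>D (p # vs). \<Phi> (A \<union> set s \<inter> set (p # vs) \<union> C) \<and>
        \<Psi> (B \<union> set s \<inter> set (p # vs) \<union> (D (p # vs) - C))) = R A B"
        using False by (simp add: R_def *)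
      then show ?thesis
        using nD False mem eq IH[of A B] N
        by (intro computesI) (auto simp: join_body_def computes_def join_cost_def)
    qed
  qed
qed

text \<open>Each chosen partner adds two variables to the state, hence \<open>2 * length ws\<close>
  in the length bound. Distinctness and \<open>x \<notin> set ws\<close> keep the variables added
  for one candidate from affecting the test of a later one; distinctness also makes list lengths
  color counts.\<close>

lemma FORGETV_runs:
  assumes "length us + length ws \<le> k" "length s + 2 * length ws \<le> k" "length vs \<le> k"
    and "\<forall>p\<in>set vs. size (enc_var p) \<le> k" "\<forall>u\<in>set ws. size (enc_var (u, u)) \<le> k"
    and "size (enc_nat l) \<le> k" "\<forall>c\<in>colors I. size (enc_nat c) \<le> k" "card (colors I) \<le> k"
    and "distinct (ws @ us)" "x \<notin> set ws"
  shows "runs FORGETV [enc_vars (map (\<lambda>u. (u, x)) ws), enc_items us, enc_vars s, enc_nat l,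
      enc_set (colors I), enc_vars vs, trie vs \<Phi> {}]
    (truth (\<exists>A\<subseteq>set ws. (\<forall>u\<in>A. (u, u) \<notin> set s) \<and> fair (colors I) (col I) l (set us \<union> A) \<and>
      \<Phi> ((set s \<union> (\<lambda>u. (u, x)) ` A \<union> (\<lambda>u. (u, u)) ` A) \<inter> set vs)))
    (2 ^ length ws * (fair_cost k + look_cost k + 40 + length ws * (mem_cost k + 80)))"
  using assms(1,2,5,9,10)
proof (induction ws arbitrary: us s)
  case Nil
  have "runs FAIR [enc_set (colors I), enc_set (colors I), enc_items us, enc_nat l]
    (truth (fair (colors I) (col I) l (set us))) (fair_cost k)"
    using assms Nil by (intro FAIR_runs_set) auto
  moreover have "runs LOOK [enc_vars vs, enc_vars s, trie vs \<Phi> {}]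
    (truth (\<Phi> (set s \<inter> set vs))) (look_cost k)"
    using assms Nil by (intro LOOK_runs_le) auto
  ultimately show ?case
    by (intro computesI) (auto simp: forgetv_body_def computes_def)
next
  case (Cons u ws)
  define R where "R us s = (\<exists>A\<subseteq>set ws. (\<forall>u\<in>A. (u, u) \<notin> set s) \<and>
    fair (colors I) (col I) l (set us \<union> A) \<and>
    \<Phi> ((set s \<union> (\<lambda>u. (u, x)) ` A \<union> (\<lambda>u. (u, u)) ` A) \<inter> set vs))" for us and s :: "(nat \<times> nat) list"
  define N where "N = 2 ^ length ws * (fair_cost k + look_cost k + 40 + length ws * (mem_cost k + 80))"
  let ?s = "(u, u) # (u, x) # s"
  have mem: "runs MEM [enc_var (u, u), enc_vars s] (truth ((u, u) \<in> set s)) (mem_cost k)"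
    using MEM_var Cons.prems by simp
  have ex: "runs FORGETV [enc_vars (map (\<lambda>u. (u, x)) ws), enc_items us, enc_vars s, enc_nat l,
      enc_set (colors I), enc_vars vs, trie vs \<Phi> {}] (truth (R us s)) N"
    unfolding R_def N_def using Cons.prems by (intro Cons.IH) auto
  have "in": "runs FORGETV [enc_vars (map (\<lambda>u. (u, x)) ws), enc_items (u # us), enc_vars ?s, enc_nat l,
      enc_set (colors I), enc_vars vs, trie vs \<Phi> {}] (truth (R (u # us) ?s)) N"
    unfolding R_def N_def using Cons.prems by (intro Cons.IH) auto
  \<comment> \<open>The summand proportional to the length pays for the work outside the two
    recursive calls.\<close>
  have N: "2 ^ length (u # ws) *
      (fair_cost k + look_cost k + 40 + length (u # ws) * (mem_cost k + 80)) \<ge> 2 * N + mem_cost k + 80"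
  proof -
    have "1 * (mem_cost k + 80) \<le> 2 ^ length (u # ws) * (mem_cost k + 80)"
      by (rule mult_le_mono1) (metis one_le_numeral one_le_power)
    then show ?thesis unfolding N_def by (simp add: algebra_simps)
  qed
  have "R (u # us) ?s \<longleftrightarrow> (\<exists>A\<subseteq>set ws. (\<forall>u\<in>A. (u, u) \<notin> set s) \<and>
    fair (colors I) (col I) l (set us \<union> insert u A) \<and>
    \<Phi> ((set s \<union> (\<lambda>u. (u, x)) ` insert u A \<union> (\<lambda>u. (u, u)) ` insert u A) \<inter> set vs))"
  proof -
    have "A \<subseteq> set ws \<Longrightarrow> (\<forall>w\<in>A. (w, w) \<notin> set ?s) \<longleftrightarrow> (\<forall>w\<in>A. (w, w) \<notin> set s)" for A
      using Cons.prems by auto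
    moreover have "set (u # us) \<union> A = set us \<union> insert u A" for A by auto
    moreover have "set ?s \<union> (\<lambda>u. (u, x)) ` A \<union> (\<lambda>u. (u, u)) ` A =
      set s \<union> (\<lambda>u. (u, x)) ` insert u A \<union> (\<lambda>u. (u, u)) ` insert u A" for A by auto
    ultimately show ?thesis unfolding R_def by (simp cong: conj_cong)
  qed
  then have "(\<exists>A\<subseteq>set (u # ws). (\<forall>u\<in>A. (u, u) \<notin> set s) \<and> fair (colors I) (col I) l (set us \<union> A) \<and>
      \<Phi> ((set s \<union> (\<lambda>u. (u, x)) ` A \<union> (\<lambda>u. (u, u)) ` A) \<inter> set vs)) \<longleftrightarrow>
    R us s \<or> (u, u) \<notin> set s \<and> R (u # us) ?s"
    unfolding list.set(2) ex_subset_insert R_def by auto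
  then show ?case
    using ex "in" mem N
    by (intro computesI) (auto simp: forgetv_body_def computes_def Dot_entry)
qed

text \<open>One variable may be prepended to \<open>s\<close>, so its length must stay strictly
  below \<open>k\<close>. Distinctness of \<open>s\<close> turns a single match in the list into a
  unique partner.\<close>

lemma FORGETU_runs:
  assumes "length s < k" "length vs \<le> k" "\<forall>p\<in>set vs. size (enc_var p) \<le> k"
    and "size (entry u) \<le> k" "distinct s"
  shows "runs FORGETU [enc_var (u, u), enc_vars s, enc_vars vs, trie vs \<Phi> {}]
    (truth ((\<forall>x. (u, x) \<notin> set s) \<and> \<Phi> (set s \<inter> set vs) \<or>
      (\<exists>!x. (u, x) \<in> set s) \<and> \<Phi> (insert (u, u) (set s) \<inter> set vs))) (forgetu_cost k)"
proof -
  let ?L = "filter (\<lambda>p. fst p = u) s"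
  have "filter (\<lambda>z. sfst z = entry u) (map enc_var s) = map enc_var ?L"
    by (induction s) auto
  then have sel: "runs SEL [entry u, enc_vars s] (enc_vars ?L) (sel_cost k)"
    using SEL_runs_le[of "map enc_var s" k "entry u"] assms by simp
  have look: "runs LOOK [enc_vars vs, enc_vars s, trie vs \<Phi> {}]
      (truth (\<Phi> (set s \<inter> set vs))) (look_cost k)"
    "runs LOOK [enc_vars vs, enc_vars ((u, u) # s), trie vs \<Phi> {}]
      (truth (\<Phi> (insert (u, u) (set s) \<inter> set vs))) (look_cost k)"
    using assms LOOK_runs_le[of s] LOOK_runs_le[of "(u, u) # s"] by auto
  define P where "P \<longleftrightarrow> \<Phi> (set s \<inter> set vs)"
  define Q where "Q \<longleftrightarrow> \<Phi> (insert (u, u) (set s) \<inter> set vs)"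
  note calls = sel look[folded P_def Q_def]
  have "runs FORGETU [enc_var (u, u), enc_vars s, enc_vars vs, trie vs \<Phi> {}]
    (truth (?L = [] \<and> P \<or> length ?L = 1 \<and> Q)) (forgetu_cost k)"
  proof -
    consider "?L = []" | p where "?L = [p]" | p q L where "?L = p # q # L" by (metis neq_Nil_conv)
    then show ?thesis
    proof cases
      case 1
      show ?thesis using calls unfolding 1
        by (intro computesI) (auto simp: forgetu_body_def computes_def forgetu_cost_def)
    next
      case 2
      show ?thesis using calls unfolding 2
        by (intro computesI) (auto simp: forgetu_body_def computes_def forgetu_cost_def)
    next
      case 3
      show ?thesis using calls unfolding 3
        by (intro computesI) (auto simp: forgetu_body_def computes_def forgetu_cost_def)
    qed
  qed
  moreover have "?L = [] \<longleftrightarrow> (\<forall>x. (u, x) \<notin> set s)"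
    by (auto simp: filter_empty_conv)
  moreover have "length ?L = 1 \<longleftrightarrow> (\<exists>!x. (u, x) \<in> set s)"
  proof -
    have "length ?L = card (set ?L)" using assms(5) by (metis distinct_card distinct_filter)
    also have "set ?L = Pair u ` {x. (u, x) \<in> set s}" by auto
    finally have "length ?L = card {x. (u, x) \<in> set s}" by (simp add: card_image inj_on_def)
    moreover have "card {x. (u, x) \<in> set s} = 1 \<longleftrightarrow> (\<exists>!x. (u, x) \<in> set s)"
      unfolding One_nat_def card_1_singleton_iff by (metis (no_types, lifting) mem_Collect_eq singletonD singletonI subsetI subset_antisym subset_singletonD empty_iff)
    ultimately show ?thesis by simp
  qed
  ultimately show ?thesis unfolding P_def Q_def by simp
qed

lemma SEL_entry:
  assumes "distinct us" "length us \<le> k" "size (enc_nat x) \<le> k"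
  shows "runs SEL [enc_nat x, enc_list (map entry us)]
    (enc_list (if x \<in> set us then [entry x] else [])) (sel_cost k)"
proof -
  have "filter (\<lambda>z. sfst z = enc_nat x) (map entry us) = map entry (filter (\<lambda>u. u = x) us)"
    by (induction us) auto
  also have "\<dots> = (if x \<in> set us then [entry x] else [])"
    unfolding filter_eq_singleton[OF assms(1)] by simp
  finally show ?thesis
    using SEL_runs_le[of "map entry us" k "enc_nat x"] assms(2,3) by (simp only: length_map)
qed

lemma INTRO_runs:
  assumes "distinct us" "length us \<le> k" "size (enc_nat x) \<le> k" "x \<in> set us \<longrightarrow> size (enc_var (x, x)) \<le> k"
    and "length s \<le> k" "length vs \<le> k" "\<forall>p\<in>set vs. size (enc_var p) \<le> k"
  shows "runs INTRO [enc_nat x, enc_list (map entry us), enc_vars s, enc_vars vs, trie vs \<Phi> {}]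
    (truth ((x \<in> set us \<longrightarrow> (x, x) \<in> set s) \<and> \<Phi> (set s \<inter> set vs)))
    (2 * sel_cost k + mem_cost k + look_cost k + 60)"
proof -
  have look: "runs LOOK [enc_vars vs, enc_vars s, trie vs \<Phi> {}]
      (truth (\<Phi> (set s \<inter> set vs))) (look_cost k)"
    using assms LOOK_runs_le[of s] by auto
  show ?thesis
  proof (cases "x \<in> set us")
    case True
    then have "runs MEM [enc_var (x, x), enc_vars s] (truth ((x, x) \<in> set s)) (mem_cost k)"
      using MEM_var assms by simp
    then show ?thesis
      using True SEL_entry[OF assms(1-3)] look
      by (intro computesI) (auto simp: intro_body_def computes_def Dot_entry)
  next
    case False
    then show ?thesis
      using SEL_entry[OF assms(1-3)] look
      by (intro computesI) (auto simp: intro_body_def computes_def)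
  qed
qed

lemma DIFF_runs:
  assumes "length ys \<le> k" "\<forall>x\<in>set xs. size (enc_nat x) \<le> k"
  shows "runs DIFF [enc_list (map enc_nat xs), enc_list (map enc_nat ys)]
    (enc_list (map enc_nat (dropWhile (\<lambda>x. x \<in> set ys) xs))) ((length xs + 1) * (mem_cost k + 20))"
  using assms(2)
proof (induction xs)
  case Nil
  show ?case by (rule computesI) (simp_all add: diff_body_def)
next
  case (Cons x xs)
  have "runs MEM [enc_nat x, enc_list (map enc_nat ys)] (truth (x \<in> set ys)) (mem_cost k)"
    using MEM_runs_le[of "map enc_nat ys" k "enc_nat x"] assms Cons by (auto simp: image_iff)
  then show ?case
    using Cons by (intro computesI) (auto simp: diff_body_def computes_def)
qed

end

section \<open>Extendable states\<close>

text \<open>Edge variables range over all left vertices, also those outside the bag, because partner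
  sets are recorded completely; a bit exists only for a left vertex of the bag. For a bipartite
  \<open>R\<close> the two kinds never coincide.\<close>

definition vars :: "'v set \<Rightarrow> ('v \<times> 'v) set \<Rightarrow> 'v set \<Rightarrow> ('v \<times> 'v) set" where
  "vars U R X = {(u, x). u \<in> U \<and> x \<in> X \<and> (x = u \<or> (u, x) \<in> R)}"

text \<open>\<open>F\<close> is the set of forgotten vertices and \<open>X\<close> is the bag. The edges of the matching at right
  vertices of the bag are in \<open>\<sigma>\<close>, those at forgotten right vertices are in \<open>M\<close>.\<close>

definition extendable :: "'v set \<Rightarrow> 'v set \<Rightarrow> ('v \<times> 'v) set \<Rightarrow> ('v \<Rightarrow> 'v set \<Rightarrow> bool) \<Rightarrow>
    'v set \<Rightarrow> 'v set \<Rightarrow> ('v \<times> 'v) set \<Rightarrow> bool" where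
  "extendable U V R \<phi> F X \<sigma> \<longleftrightarrow> (\<exists>M\<subseteq>R. (\<forall>(u, v)\<in>M. v \<in> F) \<and>
     (\<forall>v\<in>V \<inter> F. \<phi> v {u. (u, v) \<in> M}) \<and>
     (\<forall>u\<in>U \<inter> F. \<exists>!v. (u, v) \<in> M \<union> \<sigma>) \<and>
     (\<forall>u\<in>U \<inter> X. if (u, u) \<in> \<sigma> then \<forall>v. (u, v) \<notin> M else \<exists>!v. (u, v) \<in> M))"

lemma extendableI:
  assumes "M \<subseteq> R" "\<forall>(u, v)\<in>M. v \<in> F"
    and "\<And>v. v \<in> V \<inter> F \<Longrightarrow> \<phi> v {u. (u, v) \<in> M}"
    and "\<And>u. u \<in> U \<inter> F \<Longrightarrow> \<exists>!v. (u, v) \<in> M \<union> \<sigma>"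
    and "\<And>u. u \<in> U \<inter> X \<Longrightarrow> if (u, u) \<in> \<sigma> then \<forall>v. (u, v) \<notin> M else \<exists>!v. (u, v) \<in> M"
  shows "extendable U V R \<phi> F X \<sigma>"
  unfolding extendable_def by (intro exI[of _ M] conjI ballI assms)

lemma extendableE:
  assumes "extendable U V R \<phi> F X \<sigma>"
  obtains M where "M \<subseteq> R" "\<forall>(u, v)\<in>M. v \<in> F"
    and "\<forall>v\<in>V \<inter> F. \<phi> v {u. (u, v) \<in> M}"
    and "\<forall>u\<in>U \<inter> F. \<exists>!v. (u, v) \<in> M \<union> \<sigma>"
    and "\<forall>u\<in>U \<inter> X. if (u, u) \<in> \<sigma> then \<forall>v. (u, v) \<notin> M else \<exists>!v. (u, v) \<in> M"
  using assms unfolding extendable_def by (elim exE conjE)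

lemma extendable_empty: "extendable U V R \<phi> {} {} \<sigma>"
  unfolding extendable_def by (intro exI[of _ "{}"]) simp

section \<open>Recurrences for introducing, forgetting and joining\<close>

locale bipartite_relation =
  fixes U V :: "'v set" and R :: "('v \<times> 'v) set"
  assumes R: "R \<subseteq> U \<times> V" and disjoint: "U \<inter> V = {}"
begin

abbreviation "bvars \<equiv> vars U R"
abbreviation "ext \<equiv> extendable U V R"

text \<open>No neighbor of \<open>u\<close> is forgotten, so \<open>M\<close> has no edge at
  \<open>u\<close> and the bit of \<open>u\<close> must be true. For all other conditions the same
  \<open>M\<close> serves on both sides.\<close>

lemma extendable_introduce_left:
  assumes "u \<in> U" "u \<notin> F" "\<sigma> \<subseteq> bvars (insert u X)" "u \<notin> X"
    and "\<forall>v\<in>F. (u, v) \<notin> R"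
  shows "ext \<phi> F (insert u X) \<sigma> \<longleftrightarrow> (u, u) \<in> \<sigma> \<and> ext \<phi> F X (\<sigma> \<inter> bvars X)"
proof -
  have s: "(w, x) \<in> \<sigma> \<inter> bvars X \<longleftrightarrow> (w, x) \<in> \<sigma> \<and> x \<noteq> u" for w x
    using assms R disjoint unfolding vars_def by auto
  have s': "(w, u) \<in> \<sigma> \<Longrightarrow> w = u" for w
    using assms R disjoint unfolding vars_def by auto
  have *: "(\<forall>w\<in>U \<inter> F. \<exists>!v. (w, v) \<in> M \<union> \<sigma>) \<longleftrightarrow> (\<forall>w\<in>U \<inter> F. \<exists>!v. (w, v) \<in> M \<union> \<sigma> \<inter> bvars X)" for M
  proof (intro ball_cong refl arg_cong[where f = Ex1] ext)
    fix w v assume "w \<in> U \<inter> F"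
    then show "(w, v) \<in> M \<union> \<sigma> \<longleftrightarrow> (w, v) \<in> M \<union> \<sigma> \<inter> bvars X"
      using s[of w v] s'[of w] assms(2) by auto
  qed
  have **: "(\<forall>w\<in>U \<inter> insert u X. if (w, w) \<in> \<sigma> then \<forall>v. (w, v) \<notin> M else \<exists>!v. (w, v) \<in> M) \<longleftrightarrow>
     (u, u) \<in> \<sigma> \<and> (\<forall>w\<in>U \<inter> X. if (w, w) \<in> \<sigma> \<inter> bvars X then \<forall>v. (w, v) \<notin> M else \<exists>!v. (w, v) \<in> M)"
    if M: "M \<subseteq> R" "\<forall>(u, v)\<in>M. v \<in> F" for M
  proof -
    have "\<forall>v. (u, v) \<notin> M" using M assms(5) by blast
    moreover have "(w, w) \<in> \<sigma> \<inter> bvars X \<longleftrightarrow> (w, w) \<in> \<sigma>" if "w \<in> U \<inter> X" for w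
      using s[of w w] that assms(4) by auto
    moreover have "U \<inter> insert u X = insert u (U \<inter> X)" using assms(1) by auto
    ultimately show ?thesis unfolding ball_simps(7)[symmetric] by (simp cong: ball_cong) (argo | blast)
  qed
  show ?thesis
    unfolding extendable_def * using ** by (smt (verit, best))
qed

text \<open>The new edge variables belong to left vertices that are not forgotten, while
  \<open>extendable\<close> looks at the edge variables of forgotten ones only.\<close>

lemma extendable_introduce_right:
  assumes "x \<in> V" "\<sigma> \<subseteq> bvars (insert x X)" "x \<notin> X" "\<forall>u\<in>F. (u, x) \<notin> R"
  shows "ext \<phi> F (insert x X) \<sigma> \<longleftrightarrow> ext \<phi> F X (\<sigma> \<inter> bvars X)"
proof -
  have s: "(w, y) \<in> \<sigma> \<inter> bvars X \<longleftrightarrow> (w, y) \<in> \<sigma> \<and> y \<noteq> x" for w y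
    using assms R disjoint unfolding vars_def by auto
  have s': "w \<in> F \<Longrightarrow> (w, x) \<in> \<sigma> \<Longrightarrow> w \<notin> U" for w
    using assms R disjoint unfolding vars_def by auto
  have *: "(\<forall>w\<in>U \<inter> F. \<exists>!v. (w, v) \<in> M \<union> \<sigma>) \<longleftrightarrow> (\<forall>w\<in>U \<inter> F. \<exists>!v. (w, v) \<in> M \<union> \<sigma> \<inter> bvars X)" for M
  proof (intro ball_cong refl arg_cong[where f = Ex1] ext)
    fix w v assume "w \<in> U \<inter> F"
    then show "(w, v) \<in> M \<union> \<sigma> \<longleftrightarrow> (w, v) \<in> M \<union> \<sigma> \<inter> bvars X"
      using s[of w v] s'[of w] by auto
  qed
  have "U \<inter> insert x X = U \<inter> X" using assms(1) disjoint by auto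
  moreover have "w \<in> U \<Longrightarrow> (w, w) \<in> \<sigma> \<inter> bvars X \<longleftrightarrow> (w, w) \<in> \<sigma>" for w
    using s[of w w] assms(1) disjoint by auto
  ultimately show ?thesis
    unfolding extendable_def * by (simp cong: conj_cong)
qed

text \<open>Edges of \<open>M\<close> end in \<open>F\<close> and edges of \<open>\<sigma>\<close>
  at \<open>u\<close> end in the bag, so a unique partner of \<open>u\<close> lies in exactly one of
  the two. These cases are the two values of the bit of \<open>u\<close> before it is
  forgotten.\<close>

lemma extendable_forget_left:
  assumes "u \<in> U" "u \<notin> F" "u \<notin> X" "\<sigma> \<subseteq> bvars X" "F \<inter> X = {}"
  shows "ext \<phi> (insert u F) X \<sigma> \<longleftrightarrow>
    (\<forall>x. (u, x) \<notin> \<sigma>) \<and> ext \<phi> F (insert u X) \<sigma> \<or>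
    (\<exists>!x. (u, x) \<in> \<sigma>) \<and> ext \<phi> F (insert u X) (insert (u, u) \<sigma>)"
proof -
  have uu: "(u, u) \<notin> \<sigma>" using assms unfolding vars_def by auto
  \<comment> \<open>The conditions common to the three instances of \<open>extendable\<close>; they
    differ only in what they require of \<open>u\<close>.\<close>
  define P where "P M \<longleftrightarrow> M \<subseteq> R \<and> (\<forall>(u, v)\<in>M. v \<in> F) \<and> (\<forall>v\<in>V \<inter> F. \<phi> v {u. (u, v) \<in> M}) \<and>
     (\<forall>u\<in>U \<inter> F. \<exists>!v. (u, v) \<in> M \<union> \<sigma>) \<and>
     (\<forall>u\<in>U \<inter> X. if (u, u) \<in> \<sigma> then \<forall>v. (u, v) \<notin> M else \<exists>!v. (u, v) \<in> M)" for M
  have ins: "U \<inter> insert u A = insert u (U \<inter> A)" for A using assms(1) by auto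
  have l: "ext \<phi> (insert u F) X \<sigma> \<longleftrightarrow> (\<exists>M. P M \<and> (\<exists>!v. (u, v) \<in> M \<union> \<sigma>))"
  proof -
    have "u \<notin> V" using assms(1) disjoint by auto
    then have V: "V \<inter> insert u F = V \<inter> F" by auto
    have F: "M \<subseteq> R \<and> (\<forall>(w, v)\<in>M. v \<in> insert u F) \<and> B \<longleftrightarrow> M \<subseteq> R \<and> (\<forall>(w, v)\<in>M. v \<in> F) \<and> B" for M B
      using \<open>u \<notin> V\<close> R by fastforce
    show ?thesis
      unfolding extendable_def P_def V ins F ball_simps(7) by (intro ex_cong1) argo
  qed
  have r1: "ext \<phi> F (insert u X) \<sigma> \<longleftrightarrow> (\<exists>M. P M \<and> (\<exists>!v. (u, v) \<in> M))"
    unfolding extendable_def P_def ins ball_simps(7) using uu by (intro ex_cong1) argo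
  have r2: "ext \<phi> F (insert u X) (insert (u, u) \<sigma>) \<longleftrightarrow> (\<exists>M. P M \<and> (\<forall>v. (u, v) \<notin> M))"
  proof -
    have 1: "(\<forall>w\<in>U \<inter> F. \<exists>!v. (w, v) \<in> M \<union> insert (u, u) \<sigma>) \<longleftrightarrow> (\<forall>w\<in>U \<inter> F. \<exists>!v. (w, v) \<in> M \<union> \<sigma>)" for M
      using assms(2) by (intro ball_cong refl arg_cong[where f = Ex1] ext) auto
    have 2: "(\<forall>w\<in>U \<inter> insert u X. if (w, w) \<in> insert (u, u) \<sigma> then \<forall>v. (w, v) \<notin> M else \<exists>!v. (w, v) \<in> M) \<longleftrightarrow>
      (\<forall>w\<in>U \<inter> X. if (w, w) \<in> \<sigma> then \<forall>v. (w, v) \<notin> M else \<exists>!v. (w, v) \<in> M) \<and> (\<forall>v. (u, v) \<notin> M)" for M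
      using assms(1,3) by auto
    show ?thesis unfolding extendable_def P_def 1 2 by (intro ex_cong1) argo
  qed
  have "P M \<and> (\<exists>!v. (u, v) \<in> M \<union> \<sigma>) \<longleftrightarrow>
    P M \<and> ((\<forall>x. (u, x) \<notin> \<sigma>) \<and> (\<exists>!v. (u, v) \<in> M) \<or> (\<exists>!x. (u, x) \<in> \<sigma>) \<and> (\<forall>v. (u, v) \<notin> M))" for M
  proof (intro conj_cong refl)
    assume "P M"
    have FX: "(u, v) \<in> M \<Longrightarrow> (u, v) \<in> \<sigma> \<Longrightarrow> False" for v
      using \<open>P M\<close> assms(4,5) unfolding P_def vars_def by blast
    show "(\<exists>!v. (u, v) \<in> M \<union> \<sigma>) \<longleftrightarrow>
      (\<forall>x. (u, x) \<notin> \<sigma>) \<and> (\<exists>!v. (u, v) \<in> M) \<or> (\<exists>!x. (u, x) \<in> \<sigma>) \<and> (\<forall>v. (u, v) \<notin> M)"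
      using FX by (auto; metis)
  qed
  moreover have "(\<exists>M. P M \<and> (a \<and> Q M \<or> b \<and> S M)) \<longleftrightarrow>
    a \<and> (\<exists>M. P M \<and> Q M) \<or> b \<and> (\<exists>M. P M \<and> S M)" for a b Q S by blast
  ultimately show ?thesis unfolding l r1 r2 by (simp only:)
qed

text \<open>Forgetting \<open>x\<close> moves its edges, given by the partner set \<open>A\<close>,
  from the state to \<open>M\<close>. Accordingly the bit of each bag vertex in \<open>A\<close> is
  true before and false afterwards.\<close>

lemma extendable_forget_right:
  assumes "x \<in> V" "x \<notin> F" "x \<notin> X" "\<sigma> \<subseteq> bvars X" "F \<inter> X = {}"
  shows "ext \<phi> (insert x F) X \<sigma> \<longleftrightarrow>
    (\<exists>A\<subseteq>{u. (u, x) \<in> R}. (\<forall>u\<in>A. (u, u) \<notin> \<sigma>) \<and> \<phi> x A \<and>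
      ext \<phi> F (insert x X) ((\<sigma> \<union> (\<lambda>u. (u, x)) ` A \<union> (\<lambda>u. (u, u)) ` A) \<inter> bvars (insert x X)))"
proof -
  have xU: "x \<notin> U" using assms(1) disjoint by auto
  then have UX: "U \<inter> insert x Y = U \<inter> Y" for Y by auto
  \<comment> \<open>The state of the child. The intersection removes the bits of partners outside
    the bag, in particular of forgotten ones.\<close>
  define \<tau> where "\<tau> A = (\<sigma> \<union> (\<lambda>u. (u, x)) ` A \<union> (\<lambda>u. (u, u)) ` A) \<inter> bvars (insert x X)" for A
  have AU: "A \<subseteq> {u. (u, x) \<in> R} \<Longrightarrow> A \<subseteq> U" for A using R by auto
  have diag: "(u, u) \<in> \<tau> A \<longleftrightarrow> (u, u) \<in> \<sigma> \<or> u \<in> A" if "u \<in> U \<inter> X" "A \<subseteq> {u. (u, x) \<in> R}" for u A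
    using that assms xU unfolding \<tau>_def vars_def by auto
  have forgotten: "(u, y) \<in> \<tau> A \<longleftrightarrow> (u, y) \<in> \<sigma> \<or> y = x \<and> u \<in> A"
    if "u \<in> U \<inter> F" "A \<subseteq> {u. (u, x) \<in> R}" for u y A
    using that assms xU unfolding \<tau>_def vars_def by auto
  show ?thesis
    unfolding \<tau>_def[symmetric]
  proof
    assume "ext \<phi> (insert x F) X \<sigma>"
    then obtain M where M: "M \<subseteq> R" "\<forall>(u, v)\<in>M. v \<in> insert x F"
      "\<forall>v\<in>V \<inter> insert x F. \<phi> v {u. (u, v) \<in> M}" "\<forall>u\<in>U \<inter> F. \<exists>!v. (u, v) \<in> M \<union> \<sigma>"
      "\<forall>u\<in>U \<inter> X. if (u, u) \<in> \<sigma> then \<forall>v. (u, v) \<notin> M else \<exists>!v. (u, v) \<in> M"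
      by (rule extendableE) (simp only: UX)
    define A where "A = {u. (u, x) \<in> M}"
    define N where "N = {(u, v) \<in> M. v \<noteq> x}"
    have A: "A \<subseteq> {u. (u, x) \<in> R}" using M(1) by (auto simp: A_def)
    have N: "(u, v) \<in> N \<longleftrightarrow> (u, v) \<in> M \<and> v \<noteq> x" for u v by (auto simp: N_def)
    have 1: "\<forall>u\<in>A. (u, u) \<notin> \<sigma>"
    proof
      fix u assume "u \<in> A"
      then show "(u, u) \<notin> \<sigma>" using M(5) assms(4) unfolding A_def vars_def by fastforce
    qed
    have 2: "\<phi> x A" using M(3) assms(1) by (auto simp: A_def)
    have 3: "\<forall>v\<in>V \<inter> F. \<phi> v {u. (u, v) \<in> N}"
    proof
      fix v assume "v \<in> V \<inter> F"
      then have "{u. (u, v) \<in> N} = {u. (u, v) \<in> M}" using assms(2) N by auto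
      then show "\<phi> v {u. (u, v) \<in> N}" using M(3) \<open>v \<in> V \<inter> F\<close> by simp
    qed
    have 4: "\<exists>!v. (u, v) \<in> N \<union> \<tau> A" if u: "u \<in> U \<inter> F" for u
    proof -
      have "(u, v) \<in> N \<union> \<tau> A \<longleftrightarrow> (u, v) \<in> M \<union> \<sigma>" for v
        using forgotten[OF u A] N by (auto simp: A_def)
      then show ?thesis using M(4) u by simp
    qed
    have 5: "if (u, u) \<in> \<tau> A then \<forall>v. (u, v) \<notin> N else \<exists>!v. (u, v) \<in> N" if u: "u \<in> U \<inter> X" for u
    proof (cases "u \<in> A")
      case True
      then have "\<exists>!v. (u, v) \<in> M" "(u, x) \<in> M" using 1 M(5) u by (auto simp: A_def)
      then show ?thesis using True diag[OF u A] N by auto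
    next
      case False
      then have "(u, v) \<in> N \<longleftrightarrow> (u, v) \<in> M" for v using N by (auto simp: A_def)
      then show ?thesis using False diag[OF u A] M(5) u by simp
    qed
    have 0: "N \<subseteq> R" "\<forall>(u, v)\<in>N. v \<in> F" using M(1,2) by (auto simp: N_def)
    have "ext \<phi> F (insert x X) (\<tau> A)"
      by (rule extendableI[OF 0]; (rule 4 5[folded UX[of X]] bspec[OF 3], assumption))
    then show "\<exists>A\<subseteq>{u. (u, x) \<in> R}. (\<forall>u\<in>A. (u, u) \<notin> \<sigma>) \<and> \<phi> x A \<and> ext \<phi> F (insert x X) (\<tau> A)"
      using A 1 2 by blast
  next
    assume "\<exists>A\<subseteq>{u. (u, x) \<in> R}. (\<forall>u\<in>A. (u, u) \<notin> \<sigma>) \<and> \<phi> x A \<and> ext \<phi> F (insert x X) (\<tau> A)"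
    then obtain A where A: "A \<subseteq> {u. (u, x) \<in> R}" "\<forall>u\<in>A. (u, u) \<notin> \<sigma>" "\<phi> x A"
      "ext \<phi> F (insert x X) (\<tau> A)" by blast
    from A(4) obtain N where N: "N \<subseteq> R" "\<forall>(u, v)\<in>N. v \<in> F"
      "\<forall>v\<in>V \<inter> F. \<phi> v {u. (u, v) \<in> N}" "\<forall>u\<in>U \<inter> F. \<exists>!v. (u, v) \<in> N \<union> \<tau> A"
      "\<forall>u\<in>U \<inter> X. if (u, u) \<in> \<tau> A then \<forall>v. (u, v) \<notin> N else \<exists>!v. (u, v) \<in> N"
      by (rule extendableE) (simp only: UX)
    define M where "M = N \<union> (\<lambda>u. (u, x)) ` A"
    have M: "(u, v) \<in> M \<longleftrightarrow> (u, v) \<in> N \<or> u \<in> A \<and> v = x" for u v by (auto simp: M_def)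
    have Nx: "(u, x) \<notin> N" for u using N(2) assms(2) by auto
    have 1: "M \<subseteq> R" using N(1) A(1) by (auto simp: M_def)
    have 2: "\<forall>(u, v)\<in>M. v \<in> insert x F" using N(2) by (auto simp: M_def)
    have 3: "\<phi> v {u. (u, v) \<in> M}" if v: "v \<in> V \<inter> insert x F" for v
    proof (cases "v = x")
      case True
      then have "{u. (u, v) \<in> M} = A" using M Nx by auto
      then show ?thesis using A(3) True by simp
    next
      case False
      then have "{u. (u, v) \<in> M} = {u. (u, v) \<in> N}" using M by auto
      then show ?thesis using N(3) v False by simp
    qed
    have 4: "\<exists>!v. (u, v) \<in> M \<union> \<sigma>" if u: "u \<in> U \<inter> F" for u
    proof -
      have "(u, v) \<in> N \<union> \<tau> A \<longleftrightarrow> (u, v) \<in> M \<union> \<sigma>" for v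
        using forgotten[OF u A(1)] M by auto
      then have "(\<exists>!v. (u, v) \<in> N \<union> \<tau> A) \<longleftrightarrow> (\<exists>!v. (u, v) \<in> M \<union> \<sigma>)" by presburger
      then show ?thesis by (rule iffD1) (rule bspec[OF N(4) u])
    qed
    have 5: "if (u, u) \<in> \<sigma> then \<forall>v. (u, v) \<notin> M else \<exists>!v. (u, v) \<in> M" if u: "u \<in> U \<inter> X" for u
    proof (cases "u \<in> A")
      case True
      then have "(u, u) \<notin> \<sigma>" "\<forall>v. (u, v) \<notin> N" using A(2) N(5) u diag[OF u A(1)] by auto
      then show ?thesis using True M by auto
    next
      case False
      then have "(u, v) \<in> M \<longleftrightarrow> (u, v) \<in> N" for v using M by auto
      then show ?thesis using False diag[OF u A(1)] N(5) u by simp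
    qed
    show "ext \<phi> (insert x F) X \<sigma>"
      by (rule extendableI[OF 1 2]; (rule 3 4[folded UX[of F]] 5, assumption))
  qed
qed

text \<open>Without edges between \<open>F\<close> and \<open>F'\<close> the matching at forgotten
  right vertices splits into two independent halves. A left vertex of the bag with a forgotten
  partner has it in one half only, and its bit is in \<open>C\<close> if that half is
  \<open>F'\<close>.\<close>

lemma extendable_join:
  fixes \<sigma> :: "('v \<times> 'v) set"
  assumes "F \<inter> F' = {}" "F \<inter> X = {}" "F' \<inter> X = {}"
    and "\<forall>u\<in>F. \<forall>v\<in>F'. (u, v) \<notin> R" "\<forall>u\<in>F'. \<forall>v\<in>F. (u, v) \<notin> R"
  defines "D \<equiv> {p \<in> bvars X. fst p = snd p \<and> p \<notin> \<sigma>}"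
  shows "ext \<phi> (F \<union> F') X \<sigma> \<longleftrightarrow> (\<exists>C\<subseteq>D. ext \<phi> F X (\<sigma> \<union> C) \<and> ext \<phi> F' X (\<sigma> \<union> (D - C)))"
proof -
  have D: "(u, v) \<in> D \<longleftrightarrow> u \<in> U \<inter> X \<and> v = u \<and> (u, u) \<notin> \<sigma>" for u v
    unfolding D_def vars_def by auto
  show ?thesis
  proof
    assume "ext \<phi> (F \<union> F') X \<sigma>"
    then obtain M where M: "M \<subseteq> R" "\<forall>(u, v)\<in>M. v \<in> F \<union> F'"
      "\<forall>v\<in>V \<inter> (F \<union> F'). \<phi> v {u. (u, v) \<in> M}" "\<forall>u\<in>U \<inter> (F \<union> F'). \<exists>!v. (u, v) \<in> M \<union> \<sigma>"
      "\<forall>u\<in>U \<inter> X. if (u, u) \<in> \<sigma> then \<forall>v. (u, v) \<notin> M else \<exists>!v. (u, v) \<in> M"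
      by (rule extendableE)
    \<comment> \<open>Stated for a general \<open>G\<close> to treat both halves at once: restrict
      \<open>M\<close> to the edges that end in \<open>G\<close>.\<close>
    have part: "ext \<phi> G X (\<sigma> \<union> {p \<in> D. \<forall>v\<in>G. (fst p, v) \<notin> M})"
      if G: "G \<inter> X = {}" "G \<subseteq> F \<union> F'" "\<forall>u\<in>G. \<forall>v. (u, v) \<in> M \<longrightarrow> v \<in> G" for G
    proof -
      define N where "N = {(u, v) \<in> M. v \<in> G}"
      let ?\<sigma> = "\<sigma> \<union> {p \<in> D. \<forall>v\<in>G. (fst p, v) \<notin> M}"
      have N: "(u, v) \<in> N \<longleftrightarrow> (u, v) \<in> M \<and> v \<in> G" for u v by (auto simp: N_def)
      have 3: "\<phi> v {u. (u, v) \<in> N}" if v: "v \<in> V \<inter> G" for v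
      proof -
        have "{u. (u, v) \<in> N} = {u. (u, v) \<in> M}" using v N by auto
        then show ?thesis using M(3) v G(2) by auto
      qed
      have 4: "\<exists>!v. (u, v) \<in> N \<union> ?\<sigma>" if u: "u \<in> U \<inter> G" for u
      proof -
        have "(u, v) \<in> N \<union> ?\<sigma> \<longleftrightarrow> (u, v) \<in> M \<union> \<sigma>" for v
          using N D u G by auto
        then have "(\<exists>!v. (u, v) \<in> N \<union> ?\<sigma>) \<longleftrightarrow> (\<exists>!v. (u, v) \<in> M \<union> \<sigma>)" by presburger
        then show ?thesis by (rule iffD2) (rule bspec[OF M(4)], use u G(2) in blast)
      qed
      have 5: "if (u, u) \<in> ?\<sigma> then \<forall>v. (u, v) \<notin> N else \<exists>!v. (u, v) \<in> N" if u: "u \<in> U \<inter> X" for u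
      proof (cases "(u, u) \<in> \<sigma>")
        case True
        then show ?thesis using M(5) u N by auto
      next
        case False
        then have "\<exists>!v. (u, v) \<in> M" "(u, u) \<in> D" using M(5) u D by auto
        then show ?thesis using False N by auto
      qed
      have 0: "N \<subseteq> R" "\<forall>(u, v)\<in>N. v \<in> G" using M(1) by (auto simp: N_def)
      show ?thesis by (rule extendableI[OF 0]; (rule 3 4 5, assumption))
    qed
    let ?C = "{p \<in> D. \<forall>v\<in>F. (fst p, v) \<notin> M}"
    \<comment> \<open>The unique partner is in \<open>F\<close> or in \<open>F'\<close>, never in
      both.\<close>
    have "D - ?C = {p \<in> D. \<forall>v\<in>F'. (fst p, v) \<notin> M}"
    proof -
      have "(\<forall>v\<in>F. (fst p, v) \<notin> M) \<longleftrightarrow> \<not> (\<forall>v\<in>F'. (fst p, v) \<notin> M)" if "p \<in> D" for p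
      proof -
        have "\<exists>!v. (fst p, v) \<in> M" using M(5) that D[of "fst p" "snd p"] by auto
        then show ?thesis using M(2) assms(1) by blast
      qed
      then show ?thesis by blast
    qed
    moreover have "ext \<phi> F X (\<sigma> \<union> ?C)" using assms(2,4) M(1,2) by (intro part) blast+
    moreover have "ext \<phi> F' X (\<sigma> \<union> {p \<in> D. \<forall>v\<in>F'. (fst p, v) \<notin> M})"
      using assms(3,5) M(1,2) by (intro part) blast+
    ultimately show "\<exists>C\<subseteq>D. ext \<phi> F X (\<sigma> \<union> C) \<and> ext \<phi> F' X (\<sigma> \<union> (D - C))"
      by (intro exI[of _ ?C]) simp
  next
    assume "\<exists>C\<subseteq>D. ext \<phi> F X (\<sigma> \<union> C) \<and> ext \<phi> F' X (\<sigma> \<union> (D - C))"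
    then obtain C where C: "C \<subseteq> D" and ext: "ext \<phi> F X (\<sigma> \<union> C)" "ext \<phi> F' X (\<sigma> \<union> (D - C))"
      by blast
    from ext(1) obtain M where M: "M \<subseteq> R" "\<forall>(u, v)\<in>M. v \<in> F"
      "\<forall>v\<in>V \<inter> F. \<phi> v {u. (u, v) \<in> M}" "\<forall>u\<in>U \<inter> F. \<exists>!v. (u, v) \<in> M \<union> (\<sigma> \<union> C)"
      "\<forall>u\<in>U \<inter> X. if (u, u) \<in> \<sigma> \<union> C then \<forall>v. (u, v) \<notin> M else \<exists>!v. (u, v) \<in> M"
      by (rule extendableE)
    from ext(2) obtain N where N: "N \<subseteq> R" "\<forall>(u, v)\<in>N. v \<in> F'"
      "\<forall>v\<in>V \<inter> F'. \<phi> v {u. (u, v) \<in> N}" "\<forall>u\<in>U \<inter> F'. \<exists>!v. (u, v) \<in> N \<union> (\<sigma> \<union> (D - C))"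
      "\<forall>u\<in>U \<inter> X. if (u, u) \<in> \<sigma> \<union> (D - C) then \<forall>v. (u, v) \<notin> N else \<exists>!v. (u, v) \<in> N"
      by (rule extendableE)
    have 3: "\<phi> v {u. (u, v) \<in> M \<union> N}" if v: "v \<in> V \<inter> (F \<union> F')" for v
    proof (cases "v \<in> F")
      case True
      then have "{u. (u, v) \<in> M \<union> N} = {u. (u, v) \<in> M}" using N(2) assms(1) by auto
      then show ?thesis using M(3) v True by auto
    next
      case False
      then have "{u. (u, v) \<in> M \<union> N} = {u. (u, v) \<in> N}" using M(2) by auto
      then show ?thesis using N(3) v False by auto
    qed
    have 4: "\<exists>!v. (u, v) \<in> M \<union> N \<union> \<sigma>" if u: "u \<in> U \<inter> (F \<union> F')" for u
    proof (cases "u \<in> F")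
      case True
      then have "(u, v) \<in> M \<union> N \<union> \<sigma> \<longleftrightarrow> (u, v) \<in> M \<union> (\<sigma> \<union> C)" for v
        using N(1,2) assms(2,4) C D by fastforce
      then show ?thesis using M(4) u True by simp
    next
      case False
      then have "(u, v) \<in> M \<union> N \<union> \<sigma> \<longleftrightarrow> (u, v) \<in> N \<union> (\<sigma> \<union> (D - C))" for v
        using M(1,2) assms(3,5) D u by fastforce
      then show ?thesis using N(4) u False by simp
    qed
    have 5: "if (u, u) \<in> \<sigma> then \<forall>v. (u, v) \<notin> M \<union> N else \<exists>!v. (u, v) \<in> M \<union> N" if u: "u \<in> U \<inter> X" for u
    proof (cases "(u, u) \<in> \<sigma>")
      case True
      then show ?thesis using M(5) N(5) u by auto
    next
      case False
      then have "(u, u) \<in> D" using u D by simp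
      show ?thesis
      proof (cases "(u, u) \<in> C")
        case True
        then have "\<forall>v. (u, v) \<notin> M" "\<exists>!v. (u, v) \<in> N" using M(5) N(5) u False by auto
        then show ?thesis using False by auto
      next
        case nC: False
        then have "\<forall>v. (u, v) \<notin> N" "\<exists>!v. (u, v) \<in> M"
          using M(5) N(5) u False \<open>(u, u) \<in> D\<close> by auto
        then show ?thesis using False by auto
      qed
    qed
    have 0: "M \<union> N \<subseteq> R" "\<forall>(u, v)\<in>M \<union> N. v \<in> F \<union> F'" using M(1,2) N(1,2) by auto
    show "ext \<phi> (F \<union> F') X \<sigma>" by (rule extendableI[OF 0]; (rule 3 4 5, assumption))
  qed
qed

end

section \<open>Tree decompositions\<close>

abbreviation tree_edges :: "nat list set \<Rightarrow> (nat list \<times> nat list) set" where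
  "tree_edges S \<equiv> {(a, b). a \<in> S \<and> b \<in> S \<and> (\<exists>i. b = a @ [i] \<or> a = b @ [i])}"

text \<open>A path out of the subtree at \<open>[i]\<close> has to use the tree edge between
  \<open>[i]\<close> and \<open>[]\<close>. The invariant: either the path is still inside, or both
  ends of this edge are in \<open>S\<close>.\<close>

lemma connected_nodes_leave:
  assumes "connected_nodes S" "i # p \<in> S" "q \<in> S" "\<nexists>q'. q = i # q'"
  shows "[i] \<in> S" "[] \<in> S"
proof -
  have "(i # p, q) \<in> (tree_edges S)\<^sup>*"
    using assms unfolding connected_nodes_def by blast
  then have "(\<exists>q'. q = i # q') \<or> [i] \<in> S \<and> [] \<in> S"
  proof (induction rule: rtrancl_induct)
    case (step y z)
    then show ?case by (cases z) (auto simp: append_eq_Cons_conv)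
  qed simp
  then show "[i] \<in> S" "[] \<in> S" using assms(4) by auto
qed

lemma connected_nodes_child:
  assumes "connected_nodes S"
  shows "connected_nodes {p. i # p \<in> S}"
  unfolding connected_nodes_def
proof (intro ballI)
  fix p q assume pq: "p \<in> {p. i # p \<in> S}" "q \<in> {p. i # p \<in> S}"
  \<comment> \<open>Retract the tree onto the subtree: everything outside goes to its root.\<close>
  define r where "r y = (case y of j # y' \<Rightarrow> if j = i then y' else [] | [] \<Rightarrow> [])" for y
  have "(i # p, i # q) \<in> (tree_edges S)\<^sup>*"
    using assms pq unfolding connected_nodes_def by blast
  then have "(p, r (i # q)) \<in> (tree_edges {p. i # p \<in> S})\<^sup>*"
  proof (induction rule: rtrancl_induct)
    case base
    then show ?case by (simp add: r_def)
  next
    case (step y z)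
    have "r y = r z \<or> (r y, r z) \<in> tree_edges {p. i # p \<in> S}"
      using step(2) by (auto simp: r_def append_eq_Cons_conv split: list.splits)
    then show ?case
    proof
      assume "r y = r z"
      then show ?case using step(3) by simp
    qed (rule rtrancl_into_rtrancl[OF step(3)])
  qed
  then show "(p, q) \<in> (tree_edges {p. i # p \<in> S})\<^sup>*" by (simp add: r_def)
qed

section \<open>Subtrees as decompositions of the part of the graph below them\<close>

definition verts :: "'v set rtree \<Rightarrow> 'v set" where
  "verts t = (\<Union>p\<in>nodes t. bag t p)"

lemma nodes_unfold:
  "p \<in> nodes t \<longleftrightarrow> p = [] \<or> (\<exists>i q. p = i # q \<and> i < length (children t) \<and> q \<in> nodes (children t ! i))"
  unfolding nodes_def by (cases p) auto

lemma Nil_in_nodes [simp]: "[] \<in> nodes t"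
  by (simp add: nodes_def)

lemma Cons_in_nodes [simp]:
  "i # p \<in> nodes t \<longleftrightarrow> i < length (children t) \<and> p \<in> nodes (children t ! i)"
  by (simp add: nodes_def)

lemma bag_simps [simp]: "bag t [] = label t" "bag t (i # p) = bag (children t ! i) p"
  by (simp_all add: bag_def)

lemma label_subset_verts: "label t \<subseteq> verts t"
  using UN_upper[of "[]" "nodes t" "bag t"] unfolding verts_def by simp

lemma verts_unfold: "verts t = label t \<union> (\<Union>s\<in>set (children t). verts s)"
proof -
  have "nodes t = insert [] (\<Union>i<length (children t). (#) i ` nodes (children t ! i))"
    using nodes_unfold[of _ t] by auto
  then have "verts t = label t \<union> (\<Union>i<length (children t). verts (children t ! i))"
    unfolding verts_def by simp
  also have "(\<Union>i<length (children t). verts (children t ! i)) = (\<Union>s\<in>set (children t). verts s)"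
    by (auto simp: set_conv_nth)
  finally show ?thesis .
qed

definition nice_node :: "'v set rtree \<Rightarrow> bool" where
  "nice_node s \<longleftrightarrow> leaf_node s \<or> introduce_node s \<or> forget_node s \<or> join_node s"

text \<open>Weakened so that it passes to subtrees: only edges among the vertices that occur below
  need a bag, and the bag of the root is arbitrary.\<close>

definition decomposes :: "'v set set \<Rightarrow> 'v set rtree \<Rightarrow> bool" where
  "decomposes E t \<longleftrightarrow>
     (\<forall>x. connected_nodes {p \<in> nodes t. x \<in> bag t p}) \<and>
     (\<forall>e\<in>E. e \<subseteq> verts t \<longrightarrow> (\<exists>p\<in>nodes t. e \<subseteq> bag t p)) \<and>
     (\<forall>p\<in>nodes t. nice_node (subtree t p))"

lemma decomposesD:
  assumes "decomposes E t"
  shows "connected_nodes {p \<in> nodes t. x \<in> bag t p}"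
    and "e \<in> E \<Longrightarrow> e \<subseteq> verts t \<Longrightarrow> \<exists>p\<in>nodes t. e \<subseteq> bag t p"
    and "p \<in> nodes t \<Longrightarrow> nice_node (subtree t p)"
  using assms unfolding decomposes_def by simp_all

lemma nice_tree_decomposition_decomposes:
  assumes "nice_tree_decomposition W E t"
  shows "decomposes E t" "label t = {}" "verts t = W"
proof -
  show "label t = {}" "verts t = W"
    using assms unfolding nice_tree_decomposition_def tree_decomposition_def verts_def by blast+
  have "connected_nodes {p \<in> nodes t. x \<in> bag t p}" for x
  proof (cases "x \<in> W")
    case False
    then have "{p \<in> nodes t. x \<in> bag t p} = {}"
      using \<open>verts t = W\<close> unfolding verts_def by auto
    moreover have "connected_nodes {}" by (simp add: connected_nodes_def)
    ultimately show ?thesis by (simp only:)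
  qed (use assms in \<open>auto simp: nice_tree_decomposition_def tree_decomposition_def\<close>)
  then show "decomposes E t"
    using assms unfolding nice_tree_decomposition_def tree_decomposition_def decomposes_def
      nice_node_def Let_def by simp
qed

context
  fixes E :: "'v set set" and t :: "'v set rtree" and i :: nat
  assumes t: "decomposes E t" and i: "i < length (children t)"
begin

text \<open>The separator property: connectivity forces a vertex that occurs inside and outside a
  subtree into both bags of the connecting tree edge.\<close>

lemma shared_vertex:
  assumes "x \<in> verts (children t ! i)" "p \<in> nodes t" "x \<in> bag t p" "\<nexists>q. p = i # q"
  shows "x \<in> label (children t ! i)" "x \<in> label t"
proof -
  have c: "connected_nodes {p \<in> nodes t. x \<in> bag t p}" by (rule decomposesD(1)[OF t])
  obtain q where "q \<in> nodes (children t ! i)" "x \<in> bag (children t ! i) q"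
    using assms unfolding verts_def by blast
  then have q: "i # q \<in> {p \<in> nodes t. x \<in> bag t p}" using i by simp
  show "x \<in> label (children t ! i)" "x \<in> label t"
    using connected_nodes_leave[OF c q, of p] assms by auto
qed

lemma decomposes_child: "decomposes E (children t ! i)"
proof -
  have "connected_nodes {p \<in> nodes (children t ! i). x \<in> bag (children t ! i) p}" for x
    using connected_nodes_child[OF decomposesD(1)[OF t], of i x] i by simp
  moreover have "\<exists>p\<in>nodes (children t ! i). e \<subseteq> bag (children t ! i) p"
    if e: "e \<in> E" "e \<subseteq> verts (children t ! i)" for e
  proof -
    have "verts (children t ! i) \<subseteq> verts t" using i verts_unfold[of t] by auto
    then obtain p where p: "p \<in> nodes t" "e \<subseteq> bag t p"
      using decomposesD(2)[OF t e(1)] e(2) by blast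
    show ?thesis
    proof (cases "\<exists>q. p = i # q")
      case True
      then obtain q where "p = i # q" by blast
      then show ?thesis using p by (intro bexI[of _ q]) simp_all
    next
      case False
      \<comment> \<open>The bag covering \<open>e\<close> lies outside the subtree, so both ends are
        shared and lie in its top bag.\<close>
      then have "e \<subseteq> label (children t ! i)" using shared_vertex(1)[OF _ p(1)] p(2) e(2) by blast
      then show ?thesis by (intro bexI[of _ "[]"]) auto
    qed
  qed
  moreover have "nice_node (subtree (children t ! i) p)" if "p \<in> nodes (children t ! i)" for p
  proof -
    have "i # p \<in> nodes t" using that i by simp
    then show ?thesis using decomposesD(3)[OF t] by fastforce
  qed
  ultimately show ?thesis unfolding decomposes_def by simp
qed

text \<open>A bag covering the edge contains \<open>x\<close>, and a forgotten vertex occurs in no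
  bag outside the subtree.\<close>

lemma forgotten_vertex_edge:
  assumes "e \<in> E" "e \<subseteq> verts t" "x \<in> e" "x \<in> verts (children t ! i) - label (children t ! i)"
  shows "e \<subseteq> verts (children t ! i)"
proof -
  obtain p where p: "p \<in> nodes t" "e \<subseteq> bag t p"
    using decomposesD(2)[OF t assms(1,2)] by blast
  then obtain q where "p = i # q" using shared_vertex(1)[of x p] assms by blast
  then show ?thesis using p unfolding verts_def by auto
qed

end

lemma introduce_node_decomposes:
  assumes "decomposes E t" "children t = [s]" "label t = insert x (label s)" "x \<notin> label s"
  shows "decomposes E s" "verts t = insert x (verts s)" "x \<notin> verts s"
    and "{x, y} \<in> E \<Longrightarrow> y \<notin> verts s - label s"
proof -
  show "decomposes E s" using decomposes_child[OF assms(1), of 0] assms(2) by simp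
  show v: "verts t = insert x (verts s)"
    using verts_unfold[of t] assms label_subset_verts[of s] by auto
  show x: "x \<notin> verts s"
    using shared_vertex(1)[OF assms(1), of 0 x "[]"] assms by auto
  show "{x, y} \<in> E \<Longrightarrow> y \<notin> verts s - label s"
    using forgotten_vertex_edge[OF assms(1), of 0 "{x, y}" y] assms(2) v x by auto
qed

lemma forget_node_decomposes:
  assumes "decomposes E t" "children t = [s]" "label t = label s - {x}" "x \<in> label s"
  shows "decomposes E s" "verts t = verts s"
proof -
  show "decomposes E s" using decomposes_child[OF assms(1), of 0] assms(2) by simp
  show "verts t = verts s"
    using verts_unfold[of t] assms label_subset_verts[of s] by auto
qed

text \<open>A vertex below both children lies in the common bag, and an edge at a forgotten vertex
  stays below the same child. These facts are the assumptions of
  \<open>extendable_join\<close>.\<close>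

lemma join_node_decomposes:
  assumes "decomposes E t" "children t = [s, s']" "label s = label t" "label s' = label t"
  defines "F \<equiv> verts s - label t" and "F' \<equiv> verts s' - label t"
  shows "decomposes E s" "decomposes E s'" "verts t = verts s \<union> verts s'"
    and "F \<inter> F' = {}"
    and "{x, y} \<in> E \<Longrightarrow> x \<in> F \<Longrightarrow> y \<notin> F'" "{x, y} \<in> E \<Longrightarrow> x \<in> F' \<Longrightarrow> y \<notin> F"
proof -
  show "decomposes E s" "decomposes E s'"
    using decomposes_child[OF assms(1), of 0] decomposes_child[OF assms(1), of 1] assms(2) by auto
  show v: "verts t = verts s \<union> verts s'"
    using verts_unfold[of t] assms label_subset_verts[of s] by auto
  show F: "F \<inter> F' = {}"
  proof -
    have False if x: "x \<in> F" "x \<in> F'" for x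
    proof -
      obtain q where "q \<in> nodes s'" "x \<in> bag s' q" using x unfolding F'_def verts_def by blast
      then show False
        using shared_vertex(2)[OF assms(1), of 0 x "1 # q"] assms(2) x unfolding F_def by auto
    qed
    then show ?thesis by blast
  qed
  show "{x, y} \<in> E \<Longrightarrow> x \<in> F \<Longrightarrow> y \<notin> F'"
    using forgotten_vertex_edge[OF assms(1), of 0 "{x, y}" x] assms(2-4) v F unfolding F_def F'_def by auto
  show "{x, y} \<in> E \<Longrightarrow> x \<in> F' \<Longrightarrow> y \<notin> F"
    using forgotten_vertex_edge[OF assms(1), of 1 "{x, y}" x] assms(2-4) v F unfolding F_def F'_def by auto
qed

section \<open>Filling the tables\<close>

lemma dropWhile_eq_Cons:
  assumes "{y \<in> set xs. y \<notin> Y} = {x}"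
  shows "\<exists>r. dropWhile (\<lambda>y. y \<in> Y) xs = x # r"
proof (cases "dropWhile (\<lambda>y. y \<in> Y) xs")
  case Nil
  then show ?thesis using assms by auto
next
  case (Cons y r)
  then have "y \<notin> Y" "y \<in> set xs"
    by (metis (full_types) hd_dropWhile list.distinct(1) list.sel(1))
      (metis Cons list.set_intros(1) set_dropWhileD)
  then show ?thesis using assms Cons by auto
qed

section \<open>Tables of nodes and the number of variables of a bag\<close>

context valid_fair_instance
begin

definition lefts :: "nat list" where "lefts = sorted_list_of_set (left I)"

definition rel :: "(nat \<times> nat) set" where "rel = {(u, v). u \<in> left I \<and> v \<in> adj u}"

text \<open>Sorting makes the order of the variables depend on the bag alone, so the two tables at a
  join can be walked in parallel.\<close>

definition bag_vars :: "nat set \<Rightarrow> (nat \<times> nat) list" where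
  "bag_vars X = concat (map (vars_in lefts) (sorted_list_of_set X))"

definition solution :: "nat set rtree \<Rightarrow> (nat \<times> nat) set \<Rightarrow> bool" where
  "solution t = extendable (left I) (right I) rel (\<lambda>v. fair (colors I) (col I) (threshold I v))
     (verts t - label t) (label t)"

definition table :: "nat set rtree \<Rightarrow> sexp" where
  "table t = trie (bag_vars (label t)) (solution t) {}"

sublocale bipartite_relation "left I" "right I" rel
  using adj_left finite_bipartition(3) by unfold_locales (auto simp: rel_def)

lemma set_lefts [simp]: "set lefts = left I" "distinct lefts" "length lefts = card (left I)"
  using finite_bipartition by (auto simp: lefts_def)

lemma vars_in_eq: "vars_in lefts x = map (\<lambda>u. (u, x)) (filter (\<lambda>u. incident u x) lefts)"
  by (simp add: vars_in_def)

lemma set_bag_vars: "finite X \<Longrightarrow> set (bag_vars X) = bvars X"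
  by (auto simp: bag_vars_def vars_in_def vars_def rel_def incident_def)

lemma distinct_bag_vars: "distinct (bag_vars X)"
proof -
  have "distinct (concat (map (vars_in us) xs))" if "distinct us" "distinct xs" for us xs
    using that by (induction xs) (auto simp: vars_in_def distinct_map inj_on_def)
  then show ?thesis by (simp add: bag_vars_def)
qed

lemma adj_right_le: "v \<in> right I \<Longrightarrow> card (adj v) \<le> max_right_degree I"
  unfolding max_right_degree_def using finite_bipartition(2)
  by (intro cSUP_upper bdd_above_finite) auto

lemma incident_right: "v \<in> right I \<Longrightarrow> {u \<in> left I. incident u v} = adj v"
  using adj_right finite_bipartition(3) by (auto simp: incident_def)

lemma incident_left: "u \<in> left I \<Longrightarrow> {w \<in> left I. incident w u} = {u}"
  using adj_left finite_bipartition(3) by (auto simp: incident_def)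

text \<open>A left vertex contributes just its bit, a right vertex one variable for each incident
  edge; the bound covers both.\<close>

lemma length_vars_in:
  assumes "x \<in> left I \<union> right I"
  shows "length (vars_in lefts x) \<le> max_right_degree I + 1"
proof -
  have "length (vars_in lefts x) = card {u \<in> left I. incident u x}"
    using distinct_card[of "filter (\<lambda>u. incident u x) lefts"] by (simp add: vars_in_def)
  also have "\<dots> \<le> max_right_degree I + 1"
  proof (cases "x \<in> left I")
    case True
    then show ?thesis by (simp only: incident_left) simp
  next
    case False
    then have "x \<in> right I" using assms by simp
    then show ?thesis using adj_right_le[of x] by (simp only: incident_right) simp
  qed
  finally show ?thesis .
qed

lemma length_bag_vars:
  assumes "X \<subseteq> left I \<union> right I"
  shows "length (bag_vars X) \<le> (max_right_degree I + 1) * card X"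
proof -
  have fin: "finite X" using assms finite_bipartition finite_subset by blast
  have "length (concat (map (vars_in lefts) xs)) \<le> (max_right_degree I + 1) * length xs"
    if "set xs \<subseteq> left I \<union> right I" for xs
    using that
  proof (induction xs)
    case (Cons x xs)
    then show ?case using length_vars_in[of x] by simp
  qed simp
  from this[of "sorted_list_of_set X"] show ?thesis
    using fin assms by (simp add: bag_vars_def)
qed

lemma vars_mono: "X \<subseteq> Y \<Longrightarrow> bvars X \<subseteq> bvars Y"
  unfolding vars_def by auto

end

text \<open>A single \<open>k\<close> bounds every quantity in a run, so all costs are polynomials
  in \<open>k\<close>. In \<open>card_vars\<close> the product bounds the number of variables, the
  summand \<open>2 * card (left I)\<close> leaves room for those added by \<open>FORGETV\<close>,
  and strictness for the one added by \<open>FORGETU\<close>.\<close>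

locale bounded_fair_instance = valid_fair_instance +
  fixes k :: nat
  assumes card_vertices: "card (left I \<union> right I) \<le> k"
    and card_adj: "u \<in> left I \<Longrightarrow> card (adj u) < k"
    and size_vertex: "x \<in> left I \<union> right I \<Longrightarrow> size (enc_nat x) \<le> k"
    and size_threshold: "v \<in> right I \<Longrightarrow> size (enc_nat (threshold I v)) \<le> k"
    and size_color: "c \<in> colors I \<Longrightarrow> size (enc_nat c) \<le> k"
    and card_colors: "card (colors I) \<le> k"
    and size_var: "u \<in> left I \<Longrightarrow> x \<in> left I \<union> right I \<Longrightarrow> size (enc_var (u, x)) \<le> k"
    and card_vars: "card (left I) * card (left I \<union> right I) + 2 * card (left I) < k"
begin

lemma card_sides: "card (left I) \<le> k" "card (right I) \<le> k"
  using card_vertices finite_bipartition card_mono[of "left I \<union> right I"]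
  by (meson finite_UnI le_trans sup_ge1 sup_ge2)+

lemma state_length:
  assumes "distinct s" "set s \<subseteq> bvars X" "X \<subseteq> left I \<union> right I"
  shows "length s + 2 * card (left I) < k"
proof -
  have "set s \<subseteq> left I \<times> (left I \<union> right I)" using assms by (auto simp: vars_def)
  then have "card (set s) \<le> card (left I \<times> (left I \<union> right I))"
    using finite_bipartition by (intro card_mono) auto
  then show ?thesis using assms card_vars by (simp add: card_cartesian_product distinct_card)
qed

lemma size_bag_var:
  "X \<subseteq> left I \<union> right I \<Longrightarrow> p \<in> bvars X \<Longrightarrow> size (enc_var p) \<le> k"
  using size_var by (auto simp: vars_def)

lemma finite_bag: "X \<subseteq> left I \<union> right I \<Longrightarrow> finite X"
  using finite_bipartition finite_subset by blast

lemma length_bag: "X \<subseteq> left I \<union> right I \<Longrightarrow> card X \<le> k"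
  using card_vertices finite_bipartition card_mono[of "left I \<union> right I" X] by auto

lemma bag_vars_bounds:
  assumes "X \<subseteq> left I \<union> right I"
  shows "length (bag_vars X) \<le> k" "\<forall>p\<in>set (bag_vars X). size (enc_var p) \<le> k"
  using state_length[OF distinct_bag_vars, of X X] assms set_bag_vars[OF finite_bag] size_bag_var
  by auto

lemma BAGVARS_bag:
  assumes "X \<subseteq> left I \<union> right I"
  shows "runs BAGVARS [enc_set X, enc_list (map entry lefts)] (enc_vars (bag_vars X)) (bagvars_cost k)"
  unfolding enc_set_def bag_vars_def bagvars_cost_def
  using assms card_adj card_sides length_bag[OF assms] finite_bag[OF assms] size_vertex
  by (intro computes_mono[OF BAGVARS_runs]) auto

lemma SEL_threshold:
  assumes "v \<in> right I"
  shows "runs SEL [enc_nat v, enc_list (map (\<lambda>v. enc_list [enc_nat v, enc_nat (threshold I v)])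
      (sorted_list_of_set (right I)))]
    (enc_list [enc_list [enc_nat v, enc_nat (threshold I v)]]) (sel_cost k)"
proof -
  let ?f = "\<lambda>v. enc_list [enc_nat v, enc_nat (threshold I v)]"
  have "filter (\<lambda>z. sfst z = enc_nat v) (map ?f xs) = map ?f (filter (\<lambda>y. y = v) xs)" for xs
    by (induction xs) auto
  then have "filter (\<lambda>z. sfst z = enc_nat v) (map ?f (sorted_list_of_set (right I))) = [?f v]"
    using filter_eq_singleton[of "sorted_list_of_set (right I)" v] assms finite_bipartition by simp
  then show ?thesis
    using SEL_runs_le[of "map ?f (sorted_list_of_set (right I))" k "enc_nat v"]
      assms size_vertex card_sides by simp
qed

lemma enc_instance_simps:
  "sfst (enc_instance I) = enc_list (map entry lefts)"
  "sfst (ssnd (enc_instance I)) = enc_list (map (\<lambda>v. enc_list [enc_nat v, enc_nat (threshold I v)])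
      (sorted_list_of_set (right I)))"
  "sfst (ssnd (ssnd (enc_instance I))) = enc_set (colors I)"
  by (simp_all add: enc_instance_def lefts_def entry_def[abs_def])

section \<open>Correctness and cost of one table entry, by kind of node\<close>

lemma STEP_introduce:
  assumes t: "decomposes (edges I) t" "verts t \<subseteq> left I \<union> right I"
    and c: "children t = [c]" "label t = insert x (label c)" "x \<notin> label c"
    and s: "distinct s" "set s \<subseteq> bvars (label t)"
  shows "runs STEP [enc_vars s, enc_instance I, enc_list (map enc_nat (x # new)), old,
      enc_vars (bag_vars (label c)), table c]
    (truth (solution t (set s))) (step_cost k)"
proof -
  note intro = introduce_node_decomposes[OF t(1) c]
  have x: "x \<in> left I \<union> right I" and X: "label c \<subseteq> left I \<union> right I" "label t \<subseteq> left I \<union> right I"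
    using t(2) intro(2) label_subset_verts[of c] label_subset_verts[of t] by auto
  have F: "verts t - label t = verts c - label c"
    using intro(2,3) c(2,3) by auto
  have sol: "solution t (set s) \<longleftrightarrow> (x \<in> set lefts \<longrightarrow> (x, x) \<in> set s) \<and>
    solution c (set s \<inter> set (bag_vars (label c)))"
  proof (cases "x \<in> left I")
    case True
    have "\<forall>v\<in>verts c - label c. (x, v) \<notin> rel"
      using intro(4) by (auto simp: rel_def nbrs_def)
    then show ?thesis
      using extendable_introduce_left[of x "verts c - label c" "set s" "label c"] True intro(3) c s
      unfolding solution_def F set_bag_vars[OF finite_bag[OF X(1)]] by simp
  next
    case False
    have "\<forall>u\<in>verts c - label c. (u, x) \<notin> rel"
      using intro(4) by (auto simp: rel_def nbrs_def insert_commute)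
    then show ?thesis
      using extendable_introduce_right[of x "set s" "label c" "verts c - label c"] False x intro(3) c s
      unfolding solution_def F set_bag_vars[OF finite_bag[OF X(1)]] by simp
  qed
  have "runs INTRO [enc_nat x, enc_list (map entry lefts), enc_vars s,
      enc_vars (bag_vars (label c)), table c] (truth (solution t (set s)))
    (2 * sel_cost k + mem_cost k + look_cost k + 60)"
    unfolding table_def sol
    using bag_vars_bounds[OF X(1)] state_length[OF s X(2)] x size_vertex size_var card_sides
    by (intro INTRO_runs) auto
  then show ?thesis
    by (intro computesI)
      (auto simp: step_body_def computes_def enc_instance_simps step_cost_def forgetv_cost_def)
qed

lemma STEP_forget:
  assumes t: "decomposes (edges I) t" "verts t \<subseteq> left I \<union> right I"
    and c: "children t = [c]" "label t = label c - {x}" "x \<in> label c"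
    and s: "distinct s" "set s \<subseteq> bvars (label t)"
  shows "runs STEP [enc_vars s, enc_instance I, Atom, enc_list (map enc_nat (x # old)),
      enc_vars (bag_vars (label c)), table c]
    (truth (solution t (set s))) (2 ^ max_right_degree I * step_cost k)"
proof -
  note forget = forget_node_decomposes[OF t(1) c]
  have x: "x \<in> left I \<union> right I" and X: "label c \<subseteq> left I \<union> right I" "label t \<subseteq> left I \<union> right I"
    using t(2) forget(2) c(3) label_subset_verts[of c] label_subset_verts[of t] by auto
  have F: "verts t - label t = insert x (verts c - label c)"
    using forget(2) c(2,3) label_subset_verts[of c] by auto
  have lc: "label c = insert x (label t)" "x \<notin> label t" using c by auto
  have sX: "set s \<subseteq> bvars (label c)" using s(2) vars_mono[of "label t" "label c"] lc(1) by auto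
  have disj: "(verts c - label c) \<inter> label t = {}" using lc(1) by auto
  have vsc: "set (bag_vars (label c)) = bvars (label c)" using set_bag_vars finite_bag[OF X(1)] by auto
  have len: "length s + 2 * card (left I) < k" by (rule state_length[OF s X(2)])
  have sel: "runs SEL [enc_nat x, enc_list (map entry lefts)]
      (enc_list (if x \<in> left I then [entry x] else [])) (sel_cost k)"
    using SEL_entry[of lefts k x] card_sides size_vertex[OF x] by simp
  have one: "(1::nat) \<le> 2 ^ max_right_degree I" by simp
  show ?thesis
  proof (cases "x \<in> left I")
    case True
    have "(x, x) \<in> bvars (label c)" using True c(3) by (auto simp: vars_def)
    then have "solution t (set s) \<longleftrightarrow>
      (\<forall>y. (x, y) \<notin> set s) \<and> solution c (set s \<inter> set (bag_vars (label c))) \<or>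
      (\<exists>!y. (x, y) \<in> set s) \<and> solution c (insert (x, x) (set s) \<inter> set (bag_vars (label c)))"
      using extendable_forget_left[of x "verts c - label c" "label t" "set s"] True lc s(2) disj sX
      unfolding solution_def F vsc by (simp add: Int_absorb2)
    moreover have "size (entry x) \<le> k"
      using size_var[OF True x] size_enc_var(2)[of "(x, x)"] by simp
    ultimately have "runs FORGETU [enc_var (x, x), enc_vars s, enc_vars (bag_vars (label c)), table c]
      (truth (solution t (set s))) (forgetu_cost k)"
      unfolding table_def
      using FORGETU_runs[of s k "bag_vars (label c)" x "solution c"] len bag_vars_bounds[OF X(1)] s(1)
      by simp
    then have "runs STEP [enc_vars s, enc_instance I, Atom, enc_list (map enc_nat (x # old)),
      enc_vars (bag_vars (label c)), table c] (truth (solution t (set s))) (step_cost k)"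
      using sel True
      by (intro computesI)
        (auto simp: step_body_def computes_def enc_instance_simps step_cost_def Dot_entry)
    then show ?thesis by (rule computes_mono) simp
  next
    case False
    then have xr: "x \<in> right I" using x by simp
    let ?ws = "filter (\<lambda>u. incident u x) lefts"
    \<comment> \<open>As \<open>x\<close> is a right vertex, its incident left vertices are its
      neighbors; here the degree bounds the number of choices.\<close>
    have ws: "set ?ws = {u. (u, x) \<in> rel}" "length ?ws \<le> max_right_degree I" "length ?ws \<le> card (left I)"
      using incident_right[OF xr] adj_right[OF xr] adj_right_le[OF xr]
        distinct_card[of ?ws] length_filter_le[of _ lefts]
      by (auto simp: rel_def incident_def)
    have vars: "runs VARS [enc_nat x, enc_list (map entry lefts), Atom]
        (enc_vars (map (\<lambda>u. (u, x)) ?ws)) (vars_cost k)"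
      using computes_mono[OF VARS_runs[of lefts x k "[]"], of "vars_cost k"]
        size_vertex[OF x] card_adj card_sides by (simp add: vars_in_eq vars_cost_def)
    have "solution t (set s) \<longleftrightarrow> (\<exists>A\<subseteq>set ?ws. (\<forall>u\<in>A. (u, u) \<notin> set s) \<and>
      fair (colors I) (col I) (threshold I x) (set [] \<union> A) \<and>
      solution c ((set s \<union> (\<lambda>u. (u, x)) ` A \<union> (\<lambda>u. (u, u)) ` A) \<inter> set (bag_vars (label c))))"
      using extendable_forget_right[of x "verts c - label c" "label t" "set s"] xr lc s(2) disj
      unfolding solution_def F vsc ws(1) by simp
    moreover have "runs FORGETV [enc_vars (map (\<lambda>u. (u, x)) ?ws), enc_items [], enc_vars s,
        enc_nat (threshold I x), enc_set (colors I), enc_vars (bag_vars (label c)), table c]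
      (truth (\<exists>A\<subseteq>set ?ws. (\<forall>u\<in>A. (u, u) \<notin> set s) \<and>
      fair (colors I) (col I) (threshold I x) (set [] \<union> A) \<and>
      solution c ((set s \<union> (\<lambda>u. (u, x)) ` A \<union> (\<lambda>u. (u, u)) ` A) \<inter> set (bag_vars (label c)))))
      (2 ^ length ?ws * (fair_cost k + look_cost k + 40 + length ?ws * (mem_cost k + 80)))"
      unfolding table_def
      using len ws(3) card_sides bag_vars_bounds[OF X(1)] size_var size_threshold[OF xr] size_color
        card_colors False
      by (intro FORGETV_runs) auto
    moreover have "2 ^ length ?ws * (fair_cost k + look_cost k + 40 + length ?ws * (mem_cost k + 80))
        \<le> 2 ^ max_right_degree I * forgetv_cost k"
      using ws(2,3) card_sides unfolding forgetv_cost_def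
      by (intro mult_le_mono power_increasing) auto
    ultimately have fv: "runs FORGETV [enc_vars (map (\<lambda>u. (u, x)) ?ws), Atom, enc_vars s,
        enc_nat (threshold I x), enc_set (colors I), enc_vars (bag_vars (label c)), table c]
      (truth (solution t (set s))) (2 ^ max_right_degree I * forgetv_cost k)"
      by (simp add: computes_mono)
    \<comment> \<open>Costs incurred only once are multiplied by the power of two as well, which
      leaves a single factor in front.\<close>
    define r where "r = forgetu_cost k + 2 * sel_cost k + vars_cost k + mem_cost k + (100 :: nat)"
    have "r \<le> 2 ^ max_right_degree I * r" using mult_le_mono1[OF one, of r] by simp
    moreover have "2 ^ max_right_degree I * step_cost k = 2 ^ max_right_degree I * forgetv_cost k +
      2 ^ max_right_degree I * r" by (simp add: step_cost_def r_def algebra_simps)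
    ultimately have "2 ^ max_right_degree I * forgetv_cost k + r \<le> 2 ^ max_right_degree I * step_cost k"
      by simp
    then show ?thesis
      using sel False vars fv SEL_threshold[OF xr] unfolding r_def
      by (intro computesI) (auto simp: step_body_def computes_def enc_instance_simps)
  qed
qed

end

definition "node_cost k = check_cost k + 30 * k + bagvars_cost k + (130 :: nat)"

lemma enc_tree_simps [simp]:
  "sfst (enc_tree t) = enc_set (label t)" "ssnd (enc_tree t) = enc_list (map enc_tree (children t))"
  by (cases t; simp)+

context bounded_fair_instance
begin

lemma DIFF_bags:
  assumes "X \<subseteq> left I \<union> right I" "Y \<subseteq> left I \<union> right I"
  shows "runs DIFF [enc_set X, enc_set Y]
    (enc_list (map enc_nat (dropWhile (\<lambda>x. x \<in> Y) (sorted_list_of_set X)))) (diff_cost k)"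
proof -
  have "runs DIFF [enc_set X, enc_set Y]
    (enc_list (map enc_nat (dropWhile (\<lambda>x. x \<in> set (sorted_list_of_set Y)) (sorted_list_of_set X))))
    (diff_cost k)"
    unfolding enc_set_def diff_cost_def
    using assms finite_bag length_bag size_vertex by (intro computes_mono[OF DIFF_runs[of _ k]]) auto
  then show ?thesis using finite_bag[OF assms(2)] by simp
qed

abbreviation "check_args t s a b \<equiv> [enc_vars s, enc_instance I, enc_set (label t),
  enc_list (map enc_tree (children t)), a, b]"

lemma CHECK_introduce:
  assumes t: "decomposes (edges I) t" "verts t \<subseteq> left I \<union> right I"
    and c: "children t = [c]" "label t = insert x (label c)" "x \<notin> label c"
    and s: "distinct s" "set s \<subseteq> bvars (label t)"
  shows "runs CHECK (check_args t s (table c) b) (truth (solution t (set s))) (check_cost k)"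
proof -
  have X: "label c \<subseteq> left I \<union> right I" "label t \<subseteq> left I \<union> right I"
    using t(2) c(2) label_subset_verts[of t] by auto
  have "{y \<in> set (sorted_list_of_set (label t)). y \<notin> label c} = {x}"
    unfolding set_sorted_list_of_set[OF finite_bag[OF X(2)]] using c(2,3) by blast
  then obtain new where
    "dropWhile (\<lambda>y. y \<in> label c) (sorted_list_of_set (label t)) = x # new"
    using dropWhile_eq_Cons by metis
  then have "runs DIFF [enc_set (label t), enc_set (label c)]
      (enc_list (map enc_nat (x # new))) (diff_cost k)"
    using DIFF_bags[OF X(2,1)] by simp
  then show ?thesis
    using DIFF_bags[OF X] BAGVARS_bag[OF X(1)] c(1)
      STEP_introduce[OF t c s, where new = new and old = "enc_list (map enc_nat
        (dropWhile (\<lambda>x. x \<in> label t) (sorted_list_of_set (label c))))"]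
    by (intro computesI) (auto simp: check_body_def computes_def enc_instance_simps check_cost_def)
qed

lemma CHECK_forget:
  assumes t: "decomposes (edges I) t" "verts t \<subseteq> left I \<union> right I"
    and c: "children t = [c]" "label t = label c - {x}" "x \<in> label c"
    and s: "distinct s" "set s \<subseteq> bvars (label t)"
  shows "runs CHECK (check_args t s (table c) b) (truth (solution t (set s)))
    (2 ^ max_right_degree I * check_cost k)"
proof -
  have X: "label c \<subseteq> left I \<union> right I" "label t \<subseteq> left I \<union> right I"
    using t(2) forget_node_decomposes[OF t(1) c] label_subset_verts[of c] c(2) by auto
  have "{y \<in> set (sorted_list_of_set (label c)). y \<notin> label t} = {x}"
    unfolding set_sorted_list_of_set[OF finite_bag[OF X(1)]] using c(2,3) by blast
  then obtain old where
    "dropWhile (\<lambda>y. y \<in> label t) (sorted_list_of_set (label c)) = x # old"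
    using dropWhile_eq_Cons by metis
  then have old: "runs DIFF [enc_set (label c), enc_set (label t)]
      (enc_list (map enc_nat (x # old))) (diff_cost k)"
    using DIFF_bags[OF X] by simp
  have nil: "dropWhile (\<lambda>y. y \<in> label c) (sorted_list_of_set (label t)) = []"
    unfolding dropWhile_eq_Nil_conv set_sorted_list_of_set[OF finite_bag[OF X(2)]] using c(2) by blast
  then have new: "runs DIFF [enc_set (label t), enc_set (label c)] Atom (diff_cost k)"
    using DIFF_bags[OF X(2,1)] by (simp only: nil list.map enc_list_simps)
  define r where "r = bagvars_cost k + 2 * diff_cost k + (60 :: nat)"
  have "r \<le> 2 ^ max_right_degree I * r" by simp
  moreover have "2 ^ max_right_degree I * check_cost k \<ge>
      2 ^ max_right_degree I * step_cost k + 2 ^ max_right_degree I * r"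
    by (simp add: check_cost_def r_def algebra_simps)
  ultimately have "2 ^ max_right_degree I * step_cost k + r \<le> 2 ^ max_right_degree I * check_cost k"
    by linarith
  then show ?thesis
    using old new BAGVARS_bag[OF X(1)] STEP_forget[OF t c s, where old = old] c(1) unfolding r_def
    by (intro computesI) (auto simp: check_body_def computes_def enc_instance_simps)
qed

lemma CHECK_join:
  assumes t: "decomposes (edges I) t" "verts t \<subseteq> left I \<union> right I"
    and c: "children t = [c, d]" "label c = label t" "label d = label t"
    and s: "distinct s" "set s \<subseteq> bvars (label t)"
  shows "runs CHECK (check_args t s (table c) (table d)) (truth (solution t (set s)))
    (2 ^ card (label t) * check_cost k)"
proof -
  let ?vs = "bag_vars (label t)"
  let ?D = "{p \<in> set ?vs. fst p = snd p \<and> p \<notin> set s}"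
  note join = join_node_decomposes[OF t(1) c]
  have X: "label t \<subseteq> left I \<union> right I"
    using t(2) label_subset_verts[of t] by auto
  have vs: "set ?vs = bvars (label t)" by (rule set_bag_vars[OF finite_bag[OF X]])
  have F: "verts t - label t = (verts c - label t) \<union> (verts d - label t)"
    using join(3) by auto
  have "\<forall>u\<in>verts c - label t. \<forall>v\<in>verts d - label t. (u, v) \<notin> rel"
    "\<forall>u\<in>verts d - label t. \<forall>v\<in>verts c - label t. (u, v) \<notin> rel"
    using join(5,6) by (auto simp: rel_def nbrs_def)
  then have sol: "solution t (set s) \<longleftrightarrow> (\<exists>C\<subseteq>?D. solution c ({} \<union> set s \<inter> set ?vs \<union> C) \<and>
      solution d ({} \<union> set s \<inter> set ?vs \<union> (?D - C)))"
    using extendable_join[where F = "verts c - label t" and F' = "verts d - label t"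
      and X = "label t" and \<sigma> = "set s"] join(4) s(2)
    unfolding solution_def F vs c(2,3) by (simp add: Int_absorb2 Diff_Int_distrib2)
  have "runs JOIN [enc_vars ?vs, enc_vars s, table c, table d] (truth (solution t (set s)))
    (2 ^ length (filter (\<lambda>p. fst p = snd p) ?vs) * ((length ?vs + 1) * join_cost k))"
    unfolding table_def c(2,3) sol
    using state_length[OF s X] bag_vars_bounds[OF X] distinct_bag_vars by (intro JOIN_runs) auto
  moreover have "2 ^ length (filter (\<lambda>p. fst p = snd p) ?vs) * ((length ?vs + 1) * join_cost k)
      \<le> 2 ^ card (label t) * ((k + 1) * join_cost k)"
  proof (intro mult_le_mono power_increasing)
    have "length (filter (\<lambda>p. fst p = snd p) ?vs) = card {p \<in> bvars (label t). fst p = snd p}"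
      using distinct_card[of "filter (\<lambda>p. fst p = snd p) ?vs"] distinct_bag_vars vs by simp
    also have "\<dots> \<le> card ((\<lambda>x. (x, x)) ` label t)"
      using finite_bag[OF X] by (intro card_mono) (auto simp: vars_def)
    also have "\<dots> \<le> card (label t)" using finite_bag[OF X] by (rule card_image_le)
    finally show "length (filter (\<lambda>p. fst p = snd p) ?vs) \<le> card (label t)" .
  qed (use bag_vars_bounds[OF X] in auto)
  ultimately have J: "runs JOIN [enc_vars ?vs, enc_vars s, table c, table d] (truth (solution t (set s)))
    (2 ^ card (label t) * ((k + 1) * join_cost k))"
    by (rule computes_mono)
  define r where "r = bagvars_cost k + 2 * diff_cost k + (60 :: nat)"
  have "r \<le> 2 ^ card (label t) * r" by simp
  moreover have "2 ^ card (label t) * check_cost k \<ge>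
      2 ^ card (label t) * ((k + 1) * join_cost k) + 2 ^ card (label t) * r"
    by (simp add: check_cost_def r_def algebra_simps)
  ultimately have "2 ^ card (label t) * ((k + 1) * join_cost k) + r \<le> 2 ^ card (label t) * check_cost k"
    by linarith
  then show ?thesis
    using J BAGVARS_bag[OF X] c(1) unfolding r_def
    by (intro computesI) (auto simp: check_body_def computes_def enc_instance_simps)
qed

section \<open>Whole tables and the whole tree\<close>

lemma BUILD_runs:
  assumes "\<And>s. distinct s \<Longrightarrow> set s \<subseteq> A \<Longrightarrow> runs CHECK [enc_vars s, i, x, ts, a, b] (truth (\<Phi> (set s))) T"
    and "distinct (vs @ s)" "set vs \<union> set s \<subseteq> A"
  shows "runs BUILD [enc_vars vs, enc_vars s, i, x, ts, a, b] (trie vs \<Phi> (set s))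
    (2 ^ length vs * (T + 30 * length vs + 30))"
  using assms(2,3)
proof (induction vs arbitrary: s)
  case Nil
  then show ?case using assms(1)[of s]
    by (intro computesI) (auto simp: build_body_def computes_def)
next
  case (Cons v vs)
  have "30 \<le> 2 ^ length (v # vs) * (30 :: nat)" by simp
  then have "2 * (2 ^ length vs * (T + 30 * length vs + 30)) + 30 \<le>
      2 ^ length (v # vs) * (T + 30 * length (v # vs) + 30)"
    by (simp add: algebra_simps)
  then show ?case using Cons.IH[of s] Cons.IH[of "v # s"] Cons.prems
    by (intro computesI) (auto simp: build_body_def computes_def)
qed

lemma SOLVE_Atom: "runs SOLVE [i, Atom] (Dot Atom Atom) 10"
  by (rule computesI) (simp_all add: solve_body_def)

text \<open>\<open>e\<close> is the exponent of the cost of one entry, and the variables of the bag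
  give the number of entries. Only their sum must stay within \<open>w\<close>, so entries may be
  dearer where the bag is smaller.\<close>

lemma SOLVE_node:
  assumes "children t \<noteq> []" "label t \<subseteq> left I \<union> right I"
    and "\<And>s. distinct s \<Longrightarrow> set s \<subseteq> bvars (label t) \<Longrightarrow>
      runs CHECK (check_args t s a b) (truth (solution t (set s))) (2 ^ e * check_cost k)"
    and "e + length (bag_vars (label t)) \<le> w"
    and "runs SOLVE [enc_instance I, sfst (ssnd (enc_tree t))] a m"
    and "runs SOLVE [enc_instance I, sfst (ssnd (ssnd (enc_tree t)))] b n"
  shows "runs SOLVE [enc_instance I, enc_tree t] (table t) (m + n + 2 ^ w * node_cost k)"
proof -
  let ?vs = "bag_vars (label t)"
  have "runs BUILD [enc_vars ?vs, enc_vars [], enc_instance I, enc_set (label t),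
      enc_list (map enc_tree (children t)), a, b] (trie ?vs (solution t) (set []))
    (2 ^ length ?vs * (2 ^ e * check_cost k + 30 * length ?vs + 30))"
    using assms(3) distinct_bag_vars set_bag_vars[OF finite_bag[OF assms(2)]]
    by (intro BUILD_runs) auto
  moreover have "2 ^ length ?vs * (2 ^ e * check_cost k + 30 * length ?vs + 30) \<le>
    2 ^ w * (check_cost k + 30 * k + 30)"
  proof -
    have "2 ^ e * check_cost k + 30 * length ?vs + 30 \<le> 2 ^ e * check_cost k + 1 * (30 * k + 30)"
      using bag_vars_bounds[OF assms(2)] by simp
    also have "\<dots> \<le> 2 ^ e * check_cost k + 2 ^ e * (30 * k + 30)"
      by (intro add_left_mono mult_le_mono1) simp
    also have "\<dots> = 2 ^ e * (check_cost k + 30 * k + 30)" by (simp add: algebra_simps)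
    finally have "2 ^ length ?vs * (2 ^ e * check_cost k + 30 * length ?vs + 30) \<le>
        2 ^ length ?vs * (2 ^ e * (check_cost k + 30 * k + 30))"
      by (rule mult_le_mono2)
    also have "\<dots> = 2 ^ (e + length ?vs) * (check_cost k + 30 * k + 30)"
      by (simp add: power_add)
    also have "\<dots> \<le> 2 ^ w * (check_cost k + 30 * k + 30)"
      using assms(4) by (intro mult_le_mono1 power_increasing) auto
    finally show ?thesis .
  qed
  ultimately have build: "runs BUILD [enc_vars ?vs, Atom, enc_instance I, enc_set (label t),
      enc_list (map enc_tree (children t)), a, b] (table t) (2 ^ w * (check_cost k + 30 * k + 30))"
    by (simp add: computes_mono table_def)
  have "bagvars_cost k + 100 \<le> 2 ^ w * (bagvars_cost k + 100)" by simp
  then have "2 ^ w * (check_cost k + 30 * k + 30) + (bagvars_cost k + 100) \<le> 2 ^ w * node_cost k"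
    unfolding node_cost_def by (simp add: algebra_simps)
  then show ?thesis
    using build BAGVARS_bag[OF assms(2)] assms(1,5,6)
    by (intro computesI)
      (cases "children t"; auto simp: solve_body_def computes_def enc_instance_simps)+
qed

text \<open>Every node pays for its own table, hence the factor \<open>size t\<close>; the summand
  \<open>10\<close> covers leaves and the dummy call for a missing second child.\<close>

lemma SOLVE_runs:
  assumes "decomposes (edges I) t" "verts t \<subseteq> left I \<union> right I"
    and "\<forall>p\<in>nodes t. card (bag t p) \<le> m"
  shows "runs SOLVE [enc_instance I, enc_tree t] (table t)
    (size t * (2 ^ ((max_right_degree I + 2) * m) * node_cost k + 10))"
  using assms
proof (induction t rule: rtree.induct)
  case (Node X ts)
  define t where "t = Node X ts"
  let ?N = "2 ^ ((max_right_degree I + 2) * m) * node_cost k"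
  note t = Node.prems[folded t_def]
  have ts [simp]: "children t = ts" "label t = X" by (simp_all add: t_def)
  have X: "label t \<subseteq> left I \<union> right I" using t(2) label_subset_verts[of t] by auto
  have m: "card (label t) \<le> m" using t(3) by (metis Nil_in_nodes bag_simps(1))
  have IH: "runs SOLVE [enc_instance I, enc_tree (ts ! i)] (table (ts ! i)) (size (ts ! i) * (?N + 10))"
    "card (label (ts ! i)) \<le> m" if i: "i < length ts" for i
  proof -
    have "decomposes (edges I) (ts ! i)" using decomposes_child[OF t(1), of i] i by simp
    moreover have "verts (ts ! i) \<subseteq> left I \<union> right I" using t(2) verts_unfold[of t] i by fastforce
    moreover have *: "\<forall>p\<in>nodes (ts ! i). card (bag (ts ! i) p) \<le> m"
      using t(3) i by (auto dest: bspec[of _ _ "i # _"])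
    ultimately show "runs SOLVE [enc_instance I, enc_tree (ts ! i)] (table (ts ! i)) (size (ts ! i) * (?N + 10))"
      using Node.IH[of "ts ! i"] i by simp
    show "card (label (ts ! i)) \<le> m" using * by (metis Nil_in_nodes bag_simps(1))
  qed
  have len: "length (bag_vars (label t)) \<le> (max_right_degree I + 1) * card (label t)"
    by (rule length_bag_vars[OF X])
  have nice: "nice_node t" using decomposesD(3)[OF t(1), of "[]"] by simp
  have "runs SOLVE [enc_instance I, enc_tree t] (table t) (size t * (?N + 10))"
    using nice[unfolded nice_node_def]
  proof (elim disjE)
    assume "leaf_node t"
    then have leaf: "ts = []" "X = {}" by (auto simp: leaf_node_def)
    then have "verts t = {}" using verts_unfold[of t] by simp
    then have "solution t {}" using extendable_empty by (simp add: solution_def leaf)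
    then have "table t = Dot Atom Atom" by (simp add: table_def leaf bag_vars_def)
    then have "runs SOLVE [enc_instance I, enc_tree t] (table t) 10"
      by (intro computesI) (auto simp: solve_body_def leaf)
    then show ?thesis by (rule computes_mono) (simp add: t_def)
  next
    assume "introduce_node t"
    then obtain c x where c: "ts = [c]" "x \<notin> label c" "label t = insert x (label c)"
      unfolding introduce_node_def by auto
    have "(max_right_degree I + 1) * card (label t) \<le> (max_right_degree I + 2) * m"
      using m by (intro mult_le_mono) auto
    then have "runs SOLVE [enc_instance I, enc_tree t] (table t) (size c * (?N + 10) + 10 + ?N)"
      using len c IH(1)[of 0] SOLVE_Atom CHECK_introduce[OF t(1,2) _ c(3,2), of _ "Dot Atom Atom"]
      by (intro SOLVE_node[where e = 0, OF _ X]) auto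
    then show ?thesis by (rule computes_mono) (simp add: t_def c(1) algebra_simps)
  next
    assume "forget_node t"
    then obtain c x where c: "ts = [c]" "x \<in> label c" "label t = label c - {x}"
      unfolding forget_node_def by auto
    \<comment> \<open>The vertex missing from the bag frees \<open>max_right_degree I + 1\<close> in
      the exponent, enough for guessing its partner set.\<close>
    have "label c = insert x (label t)" "x \<notin> label t" using c by auto
    then have "card (label c) = card (label t) + 1"
      using finite_bag[OF X] by simp
    then have "max_right_degree I + (max_right_degree I + 1) * card (label t) \<le>
        (max_right_degree I + 1) * card (label c)" by simp
    also have "\<dots> \<le> (max_right_degree I + 2) * m"
      using IH(2)[of 0] c(1) by (intro mult_le_mono) auto
    finally have "runs SOLVE [enc_instance I, enc_tree t] (table t) (size c * (?N + 10) + 10 + ?N)"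
      using len c IH(1)[of 0] SOLVE_Atom CHECK_forget[OF t(1,2) _ c(3,2), of _ "Dot Atom Atom"]
      by (intro SOLVE_node[where e = "max_right_degree I", OF _ X]) auto
    then show ?thesis by (rule computes_mono) (simp add: t_def c(1) algebra_simps)
  next
    assume "join_node t"
    then obtain c d where c: "ts = [c, d]" "label c = label t" "label d = label t"
      unfolding join_node_def by auto
    \<comment> \<open>The split of the bits costs one more factor 2 per bag vertex; this raises the
      exponent per vertex to \<open>max_right_degree I + 2\<close>.\<close>
    have "card (label t) + (max_right_degree I + 1) * card (label t) =
        (max_right_degree I + 2) * card (label t)" by simp
    also have "\<dots> \<le> (max_right_degree I + 2) * m"
      using m by (intro mult_le_mono) auto
    finally have "runs SOLVE [enc_instance I, enc_tree t] (table t)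
        (size c * (?N + 10) + size d * (?N + 10) + ?N)"
      using len c IH(1)[of 0] IH(1)[of 1] CHECK_join[OF t(1,2) _ c(2,3)]
      by (intro SOLVE_node[where e = "card (label t)", OF _ X]) auto
    then show ?thesis by (rule computes_mono) (simp add: t_def c(1) algebra_simps)
  qed
  then show ?case by (simp only: t_def)
qed

end

section \<open>The state of the root and matchings of the graph\<close>

context valid_fair_instance
begin

text \<open>Everything is forgotten and the bag is empty, so the condition on bag vertices is void.
  What remains is to pass between ordered pairs and unordered edges, where the two sides tell the
  ends apart.\<close>

lemma solution_root_iff:
  assumes "label t = {}" "verts t = left I \<union> right I"
  shows "solution t {} \<longleftrightarrow> generalized_fair_matching I"
proof
  assume "solution t {}"
  then have "extendable (left I) (right I) rel (\<lambda>v. fair (colors I) (col I) (threshold I v))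
    (left I \<union> right I) {} {}"
    using assms by (simp add: solution_def)
  then obtain M where M: "M \<subseteq> rel"
    "\<forall>v\<in>right I \<inter> (left I \<union> right I). fair (colors I) (col I) (threshold I v) {u. (u, v) \<in> M}"
    "\<forall>u\<in>left I \<inter> (left I \<union> right I). \<exists>!v. (u, v) \<in> M \<union> {}"
    by (rule extendableE)
  define N where "N = {{u, v} |u v. (u, v) \<in> M}"
  have sides: "u \<in> left I" "v \<in> right I" "u \<notin> right I" "v \<notin> left I" if "(u, v) \<in> M" for u v
    using that M(1) R disjoint by auto
  have "N \<subseteq> edges I" using M(1) by (auto simp: N_def rel_def nbrs_def)
  have l: "nbrs N u = {v. (u, v) \<in> M}" if "u \<in> left I" for u
    using that sides by (auto simp: N_def nbrs_def doubleton_eq_iff)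
  have r: "nbrs N v = {u. (u, v) \<in> M}" if "v \<in> right I" for v
    using that sides by (auto simp: N_def nbrs_def doubleton_eq_iff)
  have "card (nbrs N u) = 1" if u: "u \<in> left I" for u
  proof -
    have "\<exists>!v. (u, v) \<in> M" using M(3) u by simp
    then have "\<exists>v. {v. (u, v) \<in> M} = {v}" by auto
    then show ?thesis unfolding l[OF u] by auto
  qed
  then have "left_perfect (left I) (edges I) N"
    using \<open>N \<subseteq> edges I\<close> by (simp add: left_perfect_def)
  moreover have "matching_fair I N"
    using M(2) r by (simp add: matching_fair_def)
  ultimately show "generalized_fair_matching I" unfolding generalized_fair_matching_def by blast
next
  assume "generalized_fair_matching I"
  then obtain N where N: "N \<subseteq> edges I" "\<forall>u\<in>left I. card (nbrs N u) = 1" "matching_fair I N"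
    unfolding generalized_fair_matching_def left_perfect_def by blast
  define M where "M = {(u, v). u \<in> left I \<and> v \<in> nbrs N u}"
  have sub: "nbrs N x \<subseteq> adj x" for x using N(1) by (auto simp: nbrs_def)
  have "extendable (left I) (right I) rel (\<lambda>v. fair (colors I) (col I) (threshold I v))
    (left I \<union> right I) {} {}"
  proof (rule extendableI)
    show "M \<subseteq> rel" using sub by (auto simp: M_def rel_def)
    then show "\<forall>(u, v)\<in>M. v \<in> left I \<union> right I" using R by auto
    show "fair (colors I) (col I) (threshold I v) {u. (u, v) \<in> M}"
      if "v \<in> right I \<inter> (left I \<union> right I)" for v
    proof -
      have "nbrs N v \<subseteq> left I" using sub[of v] adj_right[of v] that by auto
      then have "{u. (u, v) \<in> M} = nbrs N v" by (auto simp: M_def nbrs_def insert_commute)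
      then show ?thesis using N(3) that by (simp add: matching_fair_def)
    qed
    show "\<exists>!v. (u, v) \<in> M \<union> {}" if u: "u \<in> left I \<inter> (left I \<union> right I)" for u
    proof -
      obtain v where "nbrs N u = {v}" using N(2) u card_1_singletonE by auto
      then show ?thesis using u by (auto simp: M_def)
    qed
  qed auto
  then show "solution t {}" using assms by (simp add: solution_def)
qed

end

section \<open>Polynomial bounds\<close>

lemma size_enc_list: "size (enc_list xs) = sum_list (map size xs) + length xs"
  by (induction xs) auto

lemma enc_list_bounds:
  shows "length xs \<le> size (enc_list xs)" "x \<in> set xs \<Longrightarrow> size x < size (enc_list xs)"
proof -
  show "length xs \<le> size (enc_list xs)" by (simp add: size_enc_list)
  show "x \<in> set xs \<Longrightarrow> size x < size (enc_list xs)"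
    by (induction xs) auto
qed

lemma enc_set_bounds:
  assumes "finite A"
  shows "card A \<le> size (enc_set A)" "x \<in> A \<Longrightarrow> size (enc_nat x) < size (enc_set A)"
  using enc_list_bounds(1)[of "map enc_nat (sorted_list_of_set A)"]
    enc_list_bounds(2)[of "enc_nat x" "map enc_nat (sorted_list_of_set A)"] assms
  by (auto simp: enc_set_def)

lemma size_enc_tree: "size t \<le> size (enc_tree t)"
proof (induction t rule: rtree.induct)
  case (Node X ts)
  have "size_list size ts \<le> size (enc_list (map enc_tree ts))"
    using Node by (induction ts) (auto simp: add_mono)
  then show ?case by simp
qed

text \<open>For an encoding of size at most \<open>n\<close> there are at most \<open>n\<close> left
  vertices and \<open>2 * n\<close> vertices. The terms are those of \<open>card_vars\<close>, and
  the final \<open>1\<close> makes that inequality strict.\<close>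

definition "bound n = 2 * n * n + 2 * n + (1 :: nat)"

context valid_fair_instance
begin

lemma bounded_fair_instance:
  assumes "size (enc_instance I) \<le> n"
  shows "bounded_fair_instance I (bound n)"
proof -
  let ?us = "map entry lefts"
  let ?thr = "\<lambda>v. enc_list [enc_nat v, enc_nat (threshold I v)]"
  let ?vs = "map ?thr (sorted_list_of_set (right I))"
  have enc: "enc_instance I = enc_list [enc_list ?us, enc_list ?vs, enc_set (colors I)]"
    by (simp add: enc_instance_def lefts_def entry_def[abs_def])
  have parts: "size (enc_list ?us) \<le> n" "size (enc_list ?vs) \<le> n" "size (enc_set (colors I)) \<le> n"
    using assms unfolding enc by auto
  have left: "card (left I) \<le> n" and right: "card (right I) \<le> n"
    using enc_list_bounds(1)[of ?us] enc_list_bounds(1)[of ?vs] parts by auto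
  have entry: "size (entry u) \<le> n" if "u \<in> left I" for u
    using enc_list_bounds(2)[of "entry u" ?us] parts that by auto
  have thr: "size (?thr v) \<le> n" if "v \<in> right I" for v
    using enc_list_bounds(2)[of "?thr v" ?vs] parts that finite_bipartition(2) by auto
  have vertex: "size (enc_nat x) \<le> n" if "x \<in> left I \<union> right I" for x
    using entry[of x] thr[of x] that by (auto simp: entry_def)
  have n: "2 * n + 1 \<le> bound n" "n \<le> bound n" by (simp_all add: bound_def)
  have vertices: "card (left I \<union> right I) \<le> 2 * n"
    using card_Un_le[of "left I" "right I"] left right by linarith
  show ?thesis
  proof
    show "card (left I \<union> right I) \<le> bound n" using vertices n by linarith
    show "card (adj u) < bound n" if "u \<in> left I" for u
      using enc_set_bounds(1)[OF finite_adj[OF that]] entry[OF that] n by (simp add: entry_def)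
    show "size (enc_nat x) \<le> bound n" if "x \<in> left I \<union> right I" for x
      using vertex[OF that] n by linarith
    show "size (enc_nat (threshold I v)) \<le> bound n" if "v \<in> right I" for v
      using thr[OF that] n by simp
    show "size (enc_nat c) \<le> bound n" if "c \<in> colors I" for c
      using enc_set_bounds(2)[OF finite_colors(1) that] parts n by linarith
    show "card (colors I) \<le> bound n"
      using enc_set_bounds(1)[OF finite_colors(1)] parts n by linarith
    show "size (enc_var (u, x)) \<le> bound n" if "u \<in> left I" "x \<in> left I \<union> right I" for u x
      using entry[OF that(1)] vertex[OF that(2)] n by (simp add: enc_var_def)
    have "card (left I) * card (left I \<union> right I) \<le> n * (2 * n)"
      using left vertices by (rule mult_le_mono)
    then show "card (left I) * card (left I \<union> right I) + 2 * card (left I) < bound n"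
      using left by (simp add: bound_def)
  qed
qed

end

section \<open>From bag sizes to the width and the final bound\<close>

lemma finite_nodes: "finite (nodes t)"
proof (induction t rule: rtree.induct)
  case (Node X ts)
  have "nodes (Node X ts) = insert [] (\<Union>i<length ts. (#) i ` nodes (ts ! i))"
    using nodes_unfold[of _ "Node X ts"] by auto
  then show ?case using Node by simp
qed

lemma card_bag_le_width: "p \<in> nodes t \<Longrightarrow> card (bag t p) \<le> width t + 1"
proof -
  assume "p \<in> nodes t"
  then have "card (bag t p) \<le> Max ((\<lambda>p. card (bag t p)) ` nodes t)"
    using finite_nodes by (intro Max_ge) auto
  then show ?thesis by (simp add: width_def)
qed

text \<open>The constant 16 is forced by \<open>w = 1\<close> and \<open>w = 2\<close>, where
  equality holds; \<open>w = 0\<close> relies on \<open>0 ^ 0 = 1\<close>. From 4 on,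
  \<open>w ^ w\<close> dominates \<open>4 ^ w\<close>.\<close>

lemma four_power_le: "4 ^ (w + 1) \<le> 16 * w ^ (w :: nat)"
proof -
  consider "w = 0" | "w = 1" | "w = 2" | "w = 3" | "w \<ge> 4" by linarith
  then show ?thesis
  proof cases
    case 5
    then have "4 ^ w \<le> w ^ w" by (intro power_mono) auto
    then show ?thesis by simp
  qed (auto simp: power_def)
qed

definition poly_function :: "(nat \<Rightarrow> nat) \<Rightarrow> bool" where
  "poly_function f \<longleftrightarrow> (\<exists>q. \<forall>n. f n = poly q n)"

lemma poly_function_intros:
  "poly_function (\<lambda>n. c)" "poly_function (\<lambda>n. n)"
  "poly_function f \<Longrightarrow> poly_function g \<Longrightarrow> poly_function (\<lambda>n. f n + g n)"
  "poly_function f \<Longrightarrow> poly_function g \<Longrightarrow> poly_function (\<lambda>n. f n * g n)"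
  unfolding poly_function_def
  by (rule exI[of _ "[:c:]"], simp) (rule exI[of _ "[:0, 1:]"], simp, metis poly_add, metis poly_mult)

lemmas cost_defs = mem_cost_def sel_cost_def fairc_cost_def fair_cost_def vars_cost_def
  bagvars_cost_def look_cost_def join_cost_def forgetv_cost_def forgetu_cost_def diff_cost_def
  step_cost_def check_cost_def node_cost_def

text \<open>The factor 16 is the constant of \<open>four_power_le\<close>.\<close>

definition "total_cost n = 16 * (n * (node_cost (bound n) + 10) + 20)"

lemma poly_function_total_cost: "poly_function total_cost"
  unfolding total_cost_def[abs_def] cost_defs bound_def by (intro poly_function_intros)

lemma prog_decides:
  assumes "valid_instance I" "nice_tree_decomposition (left I \<union> right I) (edges I) t"
  shows "decides_within prog (enc_input I t) (generalized_fair_matching I)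
    (total_cost (size (enc_input I t)) *
      (width t ^ width t * 2 ^ (max_right_degree I * (width t + 3))))"
proof -
  interpret valid_fair_instance I using assms(1) by unfold_locales
  define n where "n = size (enc_input I t)"
  have n: "size (enc_instance I) \<le> n" "size (enc_tree t) \<le> n"
    by (simp_all add: n_def enc_input_def)
  interpret bounded_fair_instance I "bound n" by (rule bounded_fair_instance[OF n(1)])
  note dec = nice_tree_decomposition_decomposes[OF assms(2)]
  let ?w = "width t" and ?d = "max_right_degree I"
  let ?E = "2 ^ ((?d + 2) * (?w + 1)) :: nat" and ?N = "node_cost (bound n)"
  \<comment> \<open>The root bag is empty, so its table is the truth value of its only
    state.\<close>
  have "table t = truth (generalized_fair_matching I)"
    using solution_root_iff[OF dec(2,3)] by (simp add: table_def dec(2) bag_vars_def)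
  moreover have "runs SOLVE [enc_instance I, enc_tree t] (table t) (size t * (?E * ?N + 10))"
    using dec(3) card_bag_le_width[of _ t] by (intro SOLVE_runs[OF dec(1)] ballI) blast+
  ultimately have "runs MAIN [enc_input I t] (truth (generalized_fair_matching I))
      (size t * (?E * ?N + 10) + 10)"
    by (intro computesI) (auto simp: main_body_def computes_def enc_input_def)
  then have main: "expr_defined prog [enc_input I t] (Call 0 [Var 0])"
    "expr_val prog [enc_input I t] (Call 0 [Var 0]) = truth (generalized_fair_matching I)"
    "expr_cost prog [enc_input I t] (Call 0 [Var 0]) \<le> size t * (?E * ?N + 10) + 12"
    by (simp_all add: computes_def MAIN_def)
  have "(?d + 2) * (?w + 1) = ?d * (?w + 1) + 2 * (?w + 1)" by (simp add: algebra_simps)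
  moreover have "2 ^ (2 * (?w + 1)) = (4 :: nat) ^ (?w + 1)" by (simp only: power_mult) simp
  ultimately have "?E = 2 ^ (?d * (?w + 1)) * 4 ^ (?w + 1)"
    by (simp only: power_add[of _ "?d * (?w + 1)"])
  also have "\<dots> \<le> 2 ^ (?d * (?w + 3)) * (16 * ?w ^ ?w)"
    using four_power_le by (intro mult_le_mono power_increasing) auto
  finally have E: "?E \<le> 2 ^ (?d * (?w + 3)) * (16 * ?w ^ ?w)" .
  have "size t * (?E * ?N + 10) + 12 \<le> n * (?E * ?N + 10) + 20"
    using size_enc_tree[of t] n(2) by (intro add_mono mult_le_mono1) auto
  \<comment> \<open>As \<open>?E\<close> is at least 1, the additive constants may be multiplied by
    it, so that it factors out.\<close>
  also have "\<dots> \<le> n * (?E * ?N + ?E * 10) + ?E * 20"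
    by (intro add_mono mult_le_mono2) auto
  also have "\<dots> = ?E * (n * (?N + 10) + 20)"
    by (simp add: distrib_left mult.left_commute)
  also have "\<dots> \<le> (2 ^ (?d * (?w + 3)) * (16 * ?w ^ ?w)) * (n * (?N + 10) + 20)"
    by (rule mult_le_mono1[OF E])
  also have "\<dots> = total_cost n * (?w ^ ?w * 2 ^ (?d * (?w + 3)))"
    by (simp only: total_cost_def mult.commute mult.left_commute mult.assoc)
  finally have "size t * (?E * ?N + 10) + 12 \<le> total_cost n * (?w ^ ?w * 2 ^ (?d * (?w + 3)))" .
  then have "expr_cost prog [enc_input I t] (Call 0 [Var 0]) \<le>
      total_cost n * (?w ^ ?w * 2 ^ (?d * (?w + 3)))"
    using main(3) by (rule order.trans[rotated])
  then show ?thesis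
    unfolding decides_within_def n_def[symmetric]
    by (intro exI conjI) (rule evaluates_expr_val[OF main(1)], simp only: main(2) truth_eq_Atom not_not)
qed

theorem theorem6:
  "\<exists>(P :: program) (q :: nat poly). \<forall>(I :: (nat, nat) fair_instance) (t :: nat set rtree) tw.
     valid_instance I \<longrightarrow>
     nice_tree_decomposition (left I \<union> right I) (edges I) t \<longrightarrow>
     width t = tw \<longrightarrow>
     decides_within P (enc_input I t) (generalized_fair_matching I)
       (poly q (size (enc_input I t)) * (tw ^ tw * 2 ^ (max_right_degree I * (tw + 3))))"
proof -
  obtain q where "\<forall>n. total_cost n = poly q n"
    using poly_function_total_cost unfolding poly_function_def by blast
  then show ?thesis using prog_decides by (intro exI[of _ prog] exI[of _ q]) auto
qed

end
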